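(* Let $g:S^1\to\mathbb{R}$ be a smooth, strictly positive function and let $v\in S^1$ be a unit vector. There exists a translating solution to anisotropic curve shortening flow (ACSF) with respect to $g$ that travels in the direction of $v$ with speed $1$. Furthermore, up to translations in $\mathbb{R}^2$ and time, this translator is unique.
   Context: Let $M^1$ be $\mathbb{R}$ or $S^1$ and $I\subset\mathbb{R}$ an interval. A family of curves $X:M^1\times I\to\mathbb{R}^2$ is a solution to anisotropic curve shortening flow (ACSF) with respect to a smooth positive function $g:S^1\to\mathbb{R}_+$ if $$\frac{\partial X}{\partial t}(u,t)=-g(\mathsf N)\,\kappa(u,t)\,\mathsf N(u,t)\quad\text{for all }(u,t)\in M^1\times I,$$ where $\mathsf N(u,t)$ is the unit normal and $\kappa$ the curvature with respect to it. Throughout, all curves are embedded and strictly convex ($\kappa>0$), each curve bounds a convex region, and $\mathsf N$ points towards the non-convex side, so a circle has positive curvature with respect to its outward unit normal. Flows are considered as families of (unparametrized) curves, i.e. tangential reparametrization is ignored. A translating solution (translator) travelling in the direction of the unit vector $v$ with speed $c>0$ is a solution defined for all $t\in\mathbb{R}$ whose time slices satisfy $\Gamma_t=\Gamma_0+c\,t\,v$. *)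

theory Defs
  imports "HOL-Analysis.Analysis"
begin

type_synonym plane = "real ^ 2"

(* Derivatives are taken within S, hence one-sided where S contains boundary points. This is
   meant for sets S, such as open sets or strips UNIV \<times> I with I a nondegenerate interval,
   on which derivatives within S are unique. *)
primrec C_k_on :: "nat \<Rightarrow> 'a::real_normed_vector set \<Rightarrow> ('a \<Rightarrow> 'b::real_normed_vector) \<Rightarrow> bool" where
  "C_k_on 0 S f \<longleftrightarrow> continuous_on S f"
| "C_k_on (Suc k) S f \<longleftrightarrow>
     (\<exists>f'. (\<forall>x\<in>S. (f has_derivative f' x) (at x within S)) \<and> (\<forall>h. C_k_on k S (\<lambda>x. f' x h)))"

definition smooth_on :: "'a::real_normed_vector set \<Rightarrow> ('a \<Rightarrow> 'b::real_normed_vector) \<Rightarrow> bool" where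
  "smooth_on S f \<longleftrightarrow> (\<forall>k. C_k_on k S f)"

(* The circle is the unit sphere of the plane, with the angle as local coordinate.
   Values of g off the unit sphere are irrelevant. *)
definition smooth_on_circle :: "(plane \<Rightarrow> real) \<Rightarrow> bool" where
  "smooth_on_circle g \<longleftrightarrow> smooth_on UNIV (\<lambda>\<theta>::real. g (vector [cos \<theta>, sin \<theta>]))"

(* The parameter manifold. Functions on the circle are represented by functions on the real line
   of period 2 pi. *)
datatype domain_1d = Real_Line | Circle

definition embedded_curve :: "domain_1d \<Rightarrow> (real \<Rightarrow> plane) \<Rightarrow> bool" where
  "embedded_curve M \<gamma> \<longleftrightarrow>
     smooth_on UNIV \<gamma> \<and> (\<forall>u. vector_derivative \<gamma> (at u) \<noteq> 0) \<and>
     (case M of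
        Real_Line \<Rightarrow> (\<exists>h. homeomorphism UNIV (range \<gamma>) \<gamma> h)
      | Circle \<Rightarrow> (\<forall>u. \<gamma> (u + 2 * pi) = \<gamma> u) \<and> inj_on \<gamma> {0..<2 * pi})"

definition bounds_convex_region :: "(real \<Rightarrow> plane) \<Rightarrow> plane set \<Rightarrow> bool" where
  "bounds_convex_region \<gamma> K \<longleftrightarrow>
     closed K \<and> convex K \<and> interior K \<noteq> {} \<and> frontier K = range \<gamma>"

definition unit_tangent :: "(real \<Rightarrow> plane) \<Rightarrow> real \<Rightarrow> plane" where
  "unit_tangent \<gamma> u = sgn (vector_derivative \<gamma> (at u))"

definition is_outward_normal :: "plane set \<Rightarrow> (real \<Rightarrow> plane) \<Rightarrow> real \<Rightarrow> plane \<Rightarrow> bool" where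
  "is_outward_normal K \<gamma> u n \<longleftrightarrow>
     norm n = 1 \<and> n \<bullet> unit_tangent \<gamma> u = 0 \<and> (\<forall>s>0. \<gamma> u + s *\<^sub>R n \<notin> K)"

(* Curvature with respect to the unit normal n: the derivative of the unit tangent with respect to
   arc length is - curvature * n, so a circle has positive curvature for its outward normal. *)
definition curvature :: "(real \<Rightarrow> plane) \<Rightarrow> real \<Rightarrow> plane \<Rightarrow> real" where
  "curvature \<gamma> u n =
     - (vector_derivative (unit_tangent \<gamma>) (at u) \<bullet> n) / norm (vector_derivative \<gamma> (at u))"

definition acsf_solution ::
  "(plane \<Rightarrow> real) \<Rightarrow> domain_1d \<Rightarrow> real set \<Rightarrow> (real \<Rightarrow> real \<Rightarrow> plane) \<Rightarrow> bool" where
  "acsf_solution g M I X \<longleftrightarrow>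
     is_interval I \<and> interior I \<noteq> {} \<and>
     smooth_on (UNIV \<times> I) (\<lambda>(u, t). X u t) \<and>
     (\<forall>t\<in>I. embedded_curve M (\<lambda>u. X u t) \<and>
       (\<exists>K. bounds_convex_region (\<lambda>u. X u t) K \<and>
         (\<forall>u. \<exists>n. is_outward_normal K (\<lambda>u. X u t) u n \<and>
            curvature (\<lambda>u. X u t) u n > 0 \<and>
            ((\<lambda>s. X u s) has_vector_derivative
               (- (g n * curvature (\<lambda>u. X u t) u n)) *\<^sub>R n) (at t within I))))"

(* A flow of unparametrized curves: the time slices are point sets, and they are traced out by
   some parametrized solution. *)
definition acsf_flow :: "(plane \<Rightarrow> real) \<Rightarrow> real set \<Rightarrow> (real \<Rightarrow> plane set) \<Rightarrow> bool" where
  "acsf_flow g I \<Gamma> \<longleftrightarrow>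
     (\<exists>M X. acsf_solution g M I X \<and> (\<forall>t\<in>I. \<Gamma> t = range (\<lambda>u. X u t)))"

definition acsf_translator ::
  "(plane \<Rightarrow> real) \<Rightarrow> plane \<Rightarrow> real \<Rightarrow> (real \<Rightarrow> plane set) \<Rightarrow> bool" where
  "acsf_translator g v c \<Gamma> \<longleftrightarrow>
     norm v = 1 \<and> c > 0 \<and> acsf_flow g UNIV \<Gamma> \<and> (\<forall>t. \<Gamma> t = (\<lambda>x. x + (c * t) *\<^sub>R v) ` \<Gamma> 0)"

end

theory Submission
  imports Defs
begin

text \<open>A curve translates with velocity \<open>v\<close> under the flow iff \<open>g(N) \<kappa> = - v \<bullet> N\<close>. In an
  orthonormal frame \<open>(e, v)\<close>, with the slope \<open>p\<close> of the curve as its parameter and \<open>G p\<close> the value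
  of \<open>g\<close> at the normal direction of slope \<open>p\<close>, this becomes \<open>dx = G p / (1 + p\<^sup>2) dp\<close>,
  \<open>dy = p G p / (1 + p\<^sup>2) dp\<close>, which determines the curve up to translation. Under purely normal
  motion slopes evolve by \<open>p' = - p / G p\<close>; a smooth linearising coordinate for this equation
  gives a parametrized solution in closed form, without an appeal to smooth dependence of
  ODE solutions on initial data. Conversely, for the time slice \<open>\<Gamma> 0\<close> of any translator, \<open>X u t - t v\<close>
  stays in the closed convex region, so its component along the outward normal at \<open>X u 0\<close> is
  maximal at \<open>t = 0\<close>; this yields \<open>g(N) \<kappa> = - v \<bullet> N\<close>. The set of slopes attained by the slice is
  open and closed in the real line, so the slice is the entire profile.\<close>

section \<open>Smooth functions\<close>

lemma C_k_on_Suc_imp_C_k_on: "C_k_on (Suc k) S f \<Longrightarrow> C_k_on k S f"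
proof (induction k arbitrary: f)
  case 0
  then show ?case
    by (auto intro: has_derivative_continuous_on)
next
  case (Suc k)
  from Suc.prems obtain f' where "\<And>x. x \<in> S \<Longrightarrow> (f has_derivative f' x) (at x within S)"
      "\<And>h. C_k_on (Suc k) S (\<lambda>x. f' x h)"
    unfolding C_k_on.simps(2)[of "Suc k"] by blast
  with Suc.IH show ?case
    unfolding C_k_on.simps(2)[of k] by blast
qed

lemma C_k_on_const: "C_k_on k S (\<lambda>x. c)"
proof (induction k arbitrary: c)
  case (Suc k)
  then show ?case
    by (auto intro!: exI[of _ "\<lambda>x h. 0"])
qed simp

lemma C_k_on_bounded_linear:
  assumes "bounded_linear L"
  shows "C_k_on k S f \<Longrightarrow> C_k_on k S (\<lambda>x. L (f x))"
proof (induction k arbitrary: f)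
  case 0
  then show ?case
    by (auto intro: bounded_linear.continuous_on[OF assms])
next
  case (Suc k)
  then obtain f' where "\<And>x. x \<in> S \<Longrightarrow> (f has_derivative f' x) (at x within S)"
      "\<And>h. C_k_on k S (\<lambda>x. f' x h)"
    by auto
  with Suc.IH show ?case
    unfolding C_k_on.simps
    by (intro exI[of _ "\<lambda>x h. L (f' x h)"]) (simp add: bounded_linear.has_derivative[OF assms])
qed

lemma C_k_on_linear:
  assumes "bounded_linear L"
  shows "C_k_on k S L"
proof (cases k)
  case 0
  then show ?thesis
    using bounded_linear.continuous_on[OF assms continuous_on_id] by simp
next
  case (Suc j)
  then show ?thesis
    by (auto intro!: exI[of _ "\<lambda>x. L"] C_k_on_const bounded_linear_imp_has_derivative[OF assms])
qed

lemma C_k_on_add: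
  "C_k_on k S f \<Longrightarrow> C_k_on k S g \<Longrightarrow> C_k_on k S (\<lambda>x. f x + g x)"
proof (induction k arbitrary: f g)
  case 0
  then show ?case
    by (auto intro: continuous_on_add)
next
  case (Suc k)
  from Suc.prems(1) obtain f'
    where "\<And>x. x \<in> S \<Longrightarrow> (f has_derivative f' x) (at x within S)" "\<And>h. C_k_on k S (\<lambda>x. f' x h)"
    by auto
  moreover from Suc.prems(2) obtain g'
    where "\<And>x. x \<in> S \<Longrightarrow> (g has_derivative g' x) (at x within S)" "\<And>h. C_k_on k S (\<lambda>x. g' x h)"
    by auto
  ultimately show ?case
    unfolding C_k_on.simps
    by (intro exI[of _ "\<lambda>x h. f' x h + g' x h"]) (simp add: has_derivative_add Suc.IH)
qed

lemma C_k_on_bilinear: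
  assumes "bounded_bilinear B"
  shows "C_k_on k S f \<Longrightarrow> C_k_on k S g \<Longrightarrow> C_k_on k S (\<lambda>x. B (f x) (g x))"
proof (induction k arbitrary: f g)
  case 0
  then show ?case
    by (auto intro: bounded_bilinear.continuous_on[OF assms])
next
  case (Suc k)
  from Suc.prems(1) obtain f'
    where "\<And>x. x \<in> S \<Longrightarrow> (f has_derivative f' x) (at x within S)" "\<And>h. C_k_on k S (\<lambda>x. f' x h)"
    by auto
  moreover from Suc.prems(2) obtain g'
    where "\<And>x. x \<in> S \<Longrightarrow> (g has_derivative g' x) (at x within S)" "\<And>h. C_k_on k S (\<lambda>x. g' x h)"
    by auto
  moreover have "C_k_on k S f" "C_k_on k S g"
    using Suc.prems C_k_on_Suc_imp_C_k_on by blast+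
  ultimately show ?case
    unfolding C_k_on.simps
    by (intro exI[of _ "\<lambda>x h. B (f x) (g' x h) + B (f' x h) (g x)"])
       (simp add: C_k_on_add Suc.IH bounded_bilinear.FDERIV[OF assms])
qed

lemmas C_k_on_mult = C_k_on_bilinear[OF bounded_bilinear_mult]
lemmas C_k_on_scaleR = C_k_on_bilinear[OF bounded_bilinear_scaleR]

text \<open>The derivative of \<open>1 / f\<close> contains \<open>1 / f\<close> itself; lowering
  the order of \<open>f\<close> by one lets the induction hypothesis supply this factor.\<close>

lemma C_k_on_inverse:
  fixes f :: "'a::real_normed_vector \<Rightarrow> real"
  assumes nz: "\<And>x. x \<in> S \<Longrightarrow> f x \<noteq> 0"
  shows "C_k_on k S f \<Longrightarrow> C_k_on k S (\<lambda>x. inverse (f x))"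
proof (induction k)
  case 0
  then show ?case
    using nz by (auto intro: continuous_on_inverse)
next
  case (Suc k)
  then obtain f' where f': "\<And>x. x \<in> S \<Longrightarrow> (f has_derivative f' x) (at x within S)"
      "\<And>h. C_k_on k S (\<lambda>x. f' x h)"
    by auto
  have inv: "C_k_on k S (\<lambda>x. inverse (f x))"
    using Suc C_k_on_Suc_imp_C_k_on by blast
  have "C_k_on k S (\<lambda>x. - (inverse (f x) * f' x h * inverse (f x)))" for h
    by (intro C_k_on_bounded_linear[OF bounded_linear_minus[OF bounded_linear_ident]] C_k_on_mult inv f')
  then show ?case
    using f' nz unfolding C_k_on.simps
    by (intro exI[of _ "\<lambda>x h. - (inverse (f x) * f' x h * inverse (f x))"])
       (simp add: has_derivative_inverse)
qed

text \<open>A linear map on the reals is determined by its value at 1, so the quantification over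
  directions in \<open>C_k_on\<close> reduces to one ordinary derivative.\<close>

lemma C_k_on_Suc_real_iff:
  fixes f :: "real \<Rightarrow> 'b::real_normed_vector"
  shows "C_k_on (Suc k) UNIV f \<longleftrightarrow>
    (\<exists>f'. (\<forall>x. (f has_vector_derivative f' x) (at x)) \<and> C_k_on k UNIV f')" (is "?L \<longleftrightarrow> ?R")
proof
  assume ?L
  then obtain f' where f': "\<And>x. (f has_derivative f' x) (at x)" "\<And>h. C_k_on k UNIV (\<lambda>x. f' x h)"
    by auto
  have "(f has_vector_derivative f' x 1) (at x)" for x
  proof -
    have "f' x h = h *\<^sub>R f' x 1" for h
      using linear_scale[OF has_derivative_linear[OF f'(1)[of x]], of h 1] by simp
    then have "f' x = (\<lambda>h. h *\<^sub>R f' x 1)"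
      by blast
    then show ?thesis
      using f'(1)[of x] unfolding has_vector_derivative_def by metis
  qed
  with f'(2)[of 1] show ?R
    by (intro exI[of _ "\<lambda>x. f' x 1"]) simp
next
  assume ?R
  then obtain f' where "\<And>x. (f has_vector_derivative f' x) (at x)" "C_k_on k UNIV f'"
    by blast
  then show ?L
    unfolding C_k_on.simps has_vector_derivative_def
    by (intro exI[of _ "\<lambda>x h. h *\<^sub>R f' x"])
       (simp add: C_k_on_bounded_linear[OF bounded_linear_scaleR_right])
qed

lemma smooth_on_real_iff:
  fixes f :: "real \<Rightarrow> 'b::real_normed_vector"
  shows "smooth_on UNIV f \<longleftrightarrow>
    (\<exists>f'. (\<forall>x. (f has_vector_derivative f' x) (at x)) \<and> smooth_on UNIV f')" (is "?L \<longleftrightarrow> ?R")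
proof
  assume ?L
  then have "C_k_on (Suc 0) UNIV f"
    unfolding smooth_on_def by blast
  then obtain f' where f': "\<And>x. (f has_vector_derivative f' x) (at x)"
    unfolding C_k_on_Suc_real_iff by blast
  have "C_k_on k UNIV f'" for k
  proof -
    have "C_k_on (Suc k) UNIV f"
      using \<open>?L\<close> unfolding smooth_on_def by blast
    then obtain f'' where "\<And>x. (f has_vector_derivative f'' x) (at x)" "C_k_on k UNIV f''"
      unfolding C_k_on_Suc_real_iff by blast
    \<comment> \<open>Uniqueness of derivatives identifies the witness obtained at order
      \<open>Suc k\<close> with the fixed \<open>f'\<close>, so that one derivative serves all
      orders.\<close>
    moreover from this f' have "f'' = f'"
      by (intro ext) (metis vector_derivative_at)
    ultimately show ?thesis
      by simp
  qed
  with f' show ?R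
    unfolding smooth_on_def by blast
next
  assume ?R
  then have "C_k_on (Suc k) UNIV f" for k
    unfolding C_k_on_Suc_real_iff smooth_on_def by blast
  then show ?L
    unfolding smooth_on_def using C_k_on_Suc_imp_C_k_on by blast
qed

text \<open>Passing to the derivative never leaves the class \<open>P\<close>, so induction on the
  order applies. This suits families such as parameter integrals, whose higher derivatives need not
  be tracked one by one.\<close>

lemma smooth_on_real_coinduct:
  fixes f :: "real \<Rightarrow> 'b::real_normed_vector"
  assumes "P f"
    and step: "\<And>f. P f \<Longrightarrow> \<exists>f'. (\<forall>x. (f has_vector_derivative f' x) (at x)) \<and> P f'"
  shows "smooth_on UNIV f"
proof -
  have "P f \<Longrightarrow> C_k_on k UNIV f" for k f
  proof (induction k arbitrary: f)
    case 0
    from step[OF 0] show ?case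
      by (metis C_k_on.simps(1) continuous_at_imp_continuous_on has_vector_derivative_continuous)
  next
    case (Suc k)
    from step[OF Suc.prems] show ?case
      unfolding C_k_on_Suc_real_iff using Suc.IH by blast
  qed
  with \<open>P f\<close> show ?thesis
    by (simp add: smooth_on_def)
qed

text \<open>The chain rule replaces the outer function by its derivative, so the induction runs over
  all smooth \<open>f\<close> at once.\<close>

lemma C_k_on_compose_smooth:
  fixes f :: "real \<Rightarrow> 'b::real_normed_vector" and \<phi> :: "'a::real_normed_vector \<Rightarrow> real"
  shows "smooth_on UNIV f \<Longrightarrow> C_k_on k S \<phi> \<Longrightarrow> C_k_on k S (\<lambda>x. f (\<phi> x))"
proof (induction k arbitrary: f)
  case 0
  then have "continuous_on UNIV f"
    unfolding smooth_on_def by (metis C_k_on.simps(1))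
  with 0 show ?case
    using continuous_on_compose2[of UNIV f S \<phi>] by auto
next
  case (Suc k)
  from Suc.prems(1) obtain f' where f': "\<And>x. (f has_vector_derivative f' x) (at x)" "smooth_on UNIV f'"
    unfolding smooth_on_real_iff[of f] by blast
  from Suc.prems(2) obtain \<phi>' where \<phi>': "\<And>x. x \<in> S \<Longrightarrow> (\<phi> has_derivative \<phi>' x) (at x within S)"
      "\<And>h. C_k_on k S (\<lambda>x. \<phi>' x h)"
    by auto
  have "C_k_on k S (\<lambda>x. f' (\<phi> x))"
    using Suc.IH[OF f'(2)] Suc.prems(2) C_k_on_Suc_imp_C_k_on by blast
  then have "C_k_on k S (\<lambda>x. \<phi>' x h *\<^sub>R f' (\<phi> x))" for h
    by (intro C_k_on_scaleR \<phi>')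
  moreover have "((\<lambda>x. f (\<phi> x)) has_derivative (\<lambda>h. \<phi>' x h *\<^sub>R f' (\<phi> x))) (at x within S)"
    if "x \<in> S" for x
    using has_derivative_compose[OF \<phi>'(1)[OF that] f'(1)[unfolded has_vector_derivative_def]] .
  ultimately show ?case
    unfolding C_k_on.simps by (intro exI[of _ "\<lambda>x h. \<phi>' x h *\<^sub>R f' (\<phi> x)"]) simp
qed

lemma smooth_on_add:
  "smooth_on S f \<Longrightarrow> smooth_on S g \<Longrightarrow> smooth_on S (\<lambda>x. f x + g x)"
  by (simp add: smooth_on_def C_k_on_add)

lemma smooth_on_const: "smooth_on S (\<lambda>x. c)"
  by (simp add: smooth_on_def C_k_on_const)

lemma smooth_on_linear: "bounded_linear L \<Longrightarrow> smooth_on S L"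
  by (simp add: smooth_on_def C_k_on_linear)

lemma smooth_on_mult:
  fixes f g :: "'a::real_normed_vector \<Rightarrow> real"
  shows "smooth_on S f \<Longrightarrow> smooth_on S g \<Longrightarrow> smooth_on S (\<lambda>x. f x * g x)"
  by (simp add: smooth_on_def C_k_on_mult)

lemma smooth_on_scaleR:
  "smooth_on S f \<Longrightarrow> smooth_on S g \<Longrightarrow> smooth_on S (\<lambda>x. f x *\<^sub>R g x)"
  by (simp add: smooth_on_def C_k_on_scaleR)

lemma smooth_on_inverse:
  fixes f :: "'a::real_normed_vector \<Rightarrow> real"
  shows "smooth_on S f \<Longrightarrow> (\<And>x. x \<in> S \<Longrightarrow> f x \<noteq> 0) \<Longrightarrow> smooth_on S (\<lambda>x. inverse (f x))"
  by (simp add: smooth_on_def C_k_on_inverse)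

lemma smooth_on_compose:
  fixes f :: "real \<Rightarrow> 'b::real_normed_vector" and \<phi> :: "'a::real_normed_vector \<Rightarrow> real"
  shows "smooth_on UNIV f \<Longrightarrow> smooth_on S \<phi> \<Longrightarrow> smooth_on S (\<lambda>x. f (\<phi> x))"
  by (simp add: smooth_on_def C_k_on_compose_smooth)

lemma smooth_on_imp_continuous_on: "smooth_on S f \<Longrightarrow> continuous_on S f"
  unfolding smooth_on_def by (metis C_k_on.simps(1))

lemma smooth_on_derivI:
  fixes f :: "real \<Rightarrow> real"
  shows "(\<And>x. (f has_real_derivative f' x) (at x)) \<Longrightarrow> smooth_on UNIV f' \<Longrightarrow> smooth_on UNIV f"
  unfolding smooth_on_real_iff[of f] has_real_derivative_iff_has_vector_derivative by blast

lemma smooth_on_exp: "smooth_on UNIV (exp :: real \<Rightarrow> real)"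
  by (rule smooth_on_real_coinduct[where P = "\<lambda>f. f = exp"])
     (auto simp flip: has_real_derivative_iff_has_vector_derivative)

lemma smooth_on_arctan: "smooth_on UNIV arctan"
proof (rule smooth_on_derivI)
  show "(arctan has_real_derivative inverse (1 + x * x)) (at x)" for x
    using DERIV_arctan[of x] by (simp add: power2_eq_square)
  show "smooth_on UNIV (\<lambda>x::real. inverse (1 + x * x))"
    by (intro smooth_on_inverse smooth_on_add smooth_on_const smooth_on_mult
          smooth_on_linear[OF bounded_linear_ident])
       (metis add_pos_nonneg order_less_irrefl zero_le_square zero_less_one)
qed

text \<open>Bootstrapping: the derivative \<open>1 / h' (k y)\<close> is of class C^n as soon as
  \<open>k\<close> is, which lifts \<open>k\<close> to the next order. Continuity of
  \<open>k\<close> starts the process.\<close>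

lemma smooth_on_inverse_function:
  fixes h k :: "real \<Rightarrow> real"
  assumes h': "\<And>x. (h has_real_derivative h' x) (at x)" "smooth_on UNIV h'" "\<And>x. h' x \<noteq> 0"
    and "\<And>y. h (k y) = y" and cont: "continuous_on UNIV k"
  shows "(k has_real_derivative inverse (h' (k y))) (at y)" "smooth_on UNIV k"
proof -
  have k': "(k has_real_derivative inverse (h' (k y))) (at y)" for y
    by (rule DERIV_inverse_function[where f = h and a = "y - 1" and b = "y + 1"])
       (use assms in \<open>auto simp: continuous_on_eq_continuous_at\<close>)
  then show "(k has_real_derivative inverse (h' (k y))) (at y)" .
  have "C_k_on n UNIV k" for n
  proof (induction n)
    case (Suc n)
    have "C_k_on n UNIV (\<lambda>y. inverse (h' (k y)))"
      by (intro C_k_on_inverse C_k_on_compose_smooth[OF h'(2)] Suc h'(3))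
    with k' show ?case
      unfolding C_k_on_Suc_real_iff has_real_derivative_iff_has_vector_derivative
      by (intro exI[of _ "\<lambda>y. inverse (h' (k y))"]) simp
  qed (use cont in simp)
  then show "smooth_on UNIV k"
    by (simp add: smooth_on_def)
qed

section \<open>Antiderivatives and smooth division by the coordinate\<close>

lemma continuous_real_antiderivative:
  fixes f :: "real \<Rightarrow> real"
  assumes "continuous_on UNIV f"
  obtains F where "\<And>x. (F has_real_derivative f x) (at x)"
  using einterval_antiderivative[of "- \<infinity>" \<infinity> f] assms
  by (auto simp: continuous_on_eq_continuous_at has_real_derivative_iff_has_vector_derivative)

text \<open>Differentiation under the integral multiplies the weight by \<open>\<tau>\<close> and
  replaces \<open>f\<close> by its derivative. Allowing every exponent \<open>k\<close> makes the
  family closed under differentiation.\<close>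

lemma smooth_on_weighted_average:
  fixes f :: "real \<Rightarrow> real"
  assumes "smooth_on UNIV f"
  shows "smooth_on UNIV (\<lambda>x. integral {0..1} (\<lambda>\<tau>. \<tau> ^ k * f (x * \<tau>)))"
proof (rule smooth_on_real_coinduct[where P =
      "\<lambda>q. \<exists>k f. smooth_on UNIV f \<and> q = (\<lambda>x. integral {0..1} (\<lambda>\<tau>. \<tau> ^ k * f (x * \<tau> :: real) :: real))"])
  fix q :: "real \<Rightarrow> real"
  assume "\<exists>k f. smooth_on UNIV f \<and> q = (\<lambda>x. integral {0..1} (\<lambda>\<tau>. \<tau> ^ k * f (x * \<tau>)))"
  then obtain k f where f: "smooth_on UNIV f"
    and q: "q = (\<lambda>x. integral {0..1} (\<lambda>\<tau>. \<tau> ^ k * f (x * \<tau>)))"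
    by blast
  obtain f' where f': "\<And>x. (f has_real_derivative f' x) (at x)" "smooth_on UNIV f'"
    using f unfolding smooth_on_real_iff[of f] has_real_derivative_iff_has_vector_derivative by blast
  have cont: "continuous_on S f'" "continuous_on S f" for S
    using f f'(2) smooth_on_imp_continuous_on continuous_on_subset by blast+
  have "(q has_real_derivative integral {0..1} (\<lambda>\<tau>. \<tau> ^ Suc k * f' (x * \<tau>))) (at x)" for x
    unfolding q box_real(2)[symmetric]
  proof (rule leibniz_rule_field_derivative[where U = UNIV])
    show "((\<lambda>x. \<tau> ^ k * f (x * \<tau>)) has_real_derivative \<tau> ^ Suc k * f' (x * \<tau>)) (at x within UNIV)" for x \<tau>
      by (auto intro!: derivative_eq_intros DERIV_chain2[OF f'(1)])
    show "(\<lambda>\<tau>. \<tau> ^ k * f (x * \<tau>)) integrable_on cbox 0 1" for x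
      by (intro integrable_continuous continuous_intros continuous_on_compose2[OF cont(2)]) auto
    show "continuous_on (UNIV \<times> cbox 0 1) (\<lambda>(x, \<tau>). \<tau> ^ Suc k * f' (x * \<tau>))"
      unfolding case_prod_beta
      by (intro continuous_intros continuous_on_compose2[OF cont(1)]) auto
  qed auto
  then show "\<exists>q'. (\<forall>x. (q has_vector_derivative q' x) (at x)) \<and>
      (\<exists>k f. smooth_on UNIV f \<and> q' = (\<lambda>x. integral {0..1} (\<lambda>\<tau>. \<tau> ^ k * f (x * \<tau>))))"
    unfolding has_real_derivative_iff_has_vector_derivative
    using f'(2) by (intro exI[of _ "\<lambda>x. integral {0..1} (\<lambda>\<tau>. \<tau> ^ Suc k * f' (x * \<tau>))"]) blast
qed (use assms in blast)

text \<open>Hadamard's division: integrating the derivative of \<open>f\<close> along the segment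
  from 0 to \<open>x\<close> pulls out the factor \<open>x\<close> and leaves the average of
  \<open>f' (x * \<tau>)\<close> as the quotient.\<close>

lemma smooth_factor_ident:
  fixes f :: "real \<Rightarrow> real"
  assumes "smooth_on UNIV f" "f 0 = 0"
  obtains q where "smooth_on UNIV q" "\<And>x. f x = x * q x"
proof -
  obtain f' where f': "\<And>x. (f has_vector_derivative f' x) (at x)" "smooth_on UNIV f'"
    using assms(1) unfolding smooth_on_real_iff[of f] by blast
  have "f x = x * integral {0..1} (\<lambda>\<tau>. f' (x * \<tau>))" for x
  proof -
    have "((\<lambda>\<tau>. f (x * \<tau>)) has_vector_derivative x * f' (x * \<tau>)) (at \<tau> within {0..1})" for \<tau>
      using DERIV_chain2[OF f'(1)[folded has_real_derivative_iff_has_vector_derivative]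
          DERIV_cmult_Id[of x "\<tau>" "{0..1}"]]
      by (simp add: has_real_derivative_iff_has_vector_derivative mult.commute)
    from fundamental_theorem_of_calculus[OF _ this] assms(2)
    have "((\<lambda>\<tau>. x * f' (x * \<tau>)) has_integral f x) {0..1}"
      by fastforce
    then show ?thesis
      by (metis integral_mult_right integral_unique)
  qed
  with smooth_on_weighted_average[OF f'(2), of 0] that show thesis
    by simp
qed

section \<open>Linearisation of the slope equation\<close>

lemma log_lower_bound_imp_unbounded:
  fixes F :: "real \<Rightarrow> real"
  assumes "c > 0" and "\<And>x. x \<ge> 1 \<Longrightarrow> F x \<ge> d + c * ln x"
  obtains x where "x \<ge> 1" "F x > B"
proof -
  \<comment> \<open>The second argument of \<open>max\<close> gives
    \<open>c * ln x \<ge> B - d + 1\<close>; the first one ensures \<open>x \<ge> 1\<close>.\<close>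
  define x where "x = exp (max 0 ((B - d + 1) / c))"
  have "c * ln x \<ge> B - d + 1"
    using assms(1) by (simp add: x_def max_def field_simps split: if_splits)
  moreover have "x \<ge> 1"
    by (simp add: x_def)
  ultimately show thesis
    using assms(2)[of x] that[of x] by linarith
qed

text \<open>For \<open>p > 0\<close> the logarithm \<open>Q p + ln p\<close> of
  \<open>p * exp (Q p)\<close> has derivative \<open>l * G p / p\<close>, which is at least
  \<open>l * m / p\<close>. Hence it grows at least like \<open>l * m * ln p\<close>.\<close>

lemma linearizing_coordinate_unbounded:
  fixes Q G :: "real \<Rightarrow> real"
  assumes "m > 0" "l > 0" and G: "\<And>s. G s \<ge> m"
    and Q: "\<And>s. (Q has_real_derivative q s) (at s)" and q: "\<And>s. s * q s = l * G s - 1"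
  obtains p where "p \<ge> 1" "p * exp (Q p) > B"
proof -
  have "Q p + ln p \<ge> Q 1 + (l * m) * ln p" if "p \<ge> 1" for p
  proof -
    define \<psi> where "\<psi> p = Q p + ln p - l * m * ln p" for p
    have "\<exists>y. (\<psi> has_real_derivative y) (at s) \<and> 0 \<le> y" if "1 \<le> s" for s
    proof (intro exI conjI)
      show "(\<psi> has_real_derivative q s + inverse s - l * m * inverse s) (at s)"
        unfolding \<psi>_def using that by (auto intro!: derivative_eq_intros Q simp: divide_inverse)
      have "s * (q s + inverse s - l * m * inverse s) = l * (G s - m)"
        using that q[of s] by (simp add: algebra_simps)
      also have "\<dots> \<ge> 0"
        using assms(2) G[of s] by simp
      finally show "0 \<le> q s + inverse s - l * m * inverse s"
        using that by (simp add: zero_le_mult_iff)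
    qed
    then have "\<psi> 1 \<le> \<psi> p"
      using DERIV_nonneg_imp_nondecreasing[OF that] by metis
    then show ?thesis
      by (simp add: \<psi>_def)
  qed
  moreover have "l * m > 0"
    using assms by simp
  ultimately obtain p where p: "p \<ge> 1" "Q p + ln p > B"
    using log_lower_bound_imp_unbounded[where F = "\<lambda>p. Q p + ln p" and c = "l * m" and d = "Q 1"] by metis
  have "p * exp (Q p) = exp (Q p + ln p)"
    using p by (simp add: exp_add)
  also have "\<dots> > Q p + ln p"
    using exp_ge_add_one_self[of "Q p + ln p"] by linarith
  finally show thesis
    using p that by force
qed

text \<open>The coordinate \<open>w = k\<inverse> p\<close> turns the flow \<open>p' = - p / G p\<close> into the linear flow
  \<open>w' = - w / G 0\<close>, also across the rest point \<open>0\<close>.\<close>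

lemma linearizing_coordinate:
  fixes G :: "real \<Rightarrow> real"
  assumes G: "smooth_on UNIV G" and "m > 0" and m: "\<And>s. G s \<ge> m"
  obtains k k' where "smooth_on UNIV k" "bij k"
    and "\<And>w. (k has_real_derivative k' w) (at w)" "\<And>w. k' w > 0"
    and "\<And>w. (w / G 0) * k' w = k w / G (k w)"
proof -
  have pos: "G s > 0" for s
    using m[of s] \<open>m > 0\<close> by linarith
  \<comment> \<open>This normalisation makes \<open>l * G s - 1\<close> vanish at 0, so that
    division by \<open>s\<close> leaves a smooth \<open>q\<close>.\<close>
  define l where "l = inverse (G 0)"
  have "l > 0"
    using pos by (simp add: l_def)
  have "smooth_on UNIV (\<lambda>s. l * G s + (- 1))"
    by (intro smooth_on_add smooth_on_mult smooth_on_const G)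
  moreover have "l * G 0 + (- 1) = 0"
    using pos[of 0] by (simp add: l_def)
  ultimately obtain q where q: "smooth_on UNIV q" "\<And>s. l * G s + (- 1) = s * q s"
    using smooth_factor_ident[of "\<lambda>s. l * G s + (- 1)"] by metis
  obtain Q where Q: "\<And>s. (Q has_real_derivative q s) (at s)"
    using continuous_real_antiderivative smooth_on_imp_continuous_on[OF q(1)] by blast
  \<comment> \<open>Linearisation requires \<open>p * h' p = l * G p * h p\<close>, that is,
    \<open>h' / h = 1 / p + q\<close> away from 0. The solution \<open>p * exp (Q p)\<close> stays
    regular at the rest point.\<close>
  define h h' where "h = (\<lambda>p. p * exp (Q p))" and "h' = (\<lambda>p. exp (Q p) * (l * G p))"
  have h': "(h has_real_derivative h' p) (at p)" for p
  proof -
    have "exp (Q p) + p * (exp (Q p) * q p) = h' p"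
      using q(2)[of p] unfolding h'_def by algebra
    then show ?thesis
      unfolding h_def by (auto intro!: derivative_eq_intros Q simp: algebra_simps)
  qed
  have h'_pos: "h' p > 0" for p
    using pos[of p] \<open>l > 0\<close> by (simp add: h'_def)
  have smooth_h': "smooth_on UNIV h'"
    unfolding h'_def
    by (intro smooth_on_mult smooth_on_const G smooth_on_compose[OF smooth_on_exp] smooth_on_derivI[OF Q q(1)])
  have cont_h: "continuous_on S h" for S
    by (meson DERIV_isCont continuous_at_imp_continuous_on h')
  have "strict_mono h"
  proof (rule strict_monoI)
    fix x y :: real
    assume "x < y"
    then show "h x < h y"
      by (rule DERIV_pos_imp_increasing) (auto intro!: exI h' h'_pos)
  qed
  then have "inj h"
    by (rule strict_mono_imp_inj_on)
  have "surj h"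
  proof (unfold surj_def, intro allI)
    fix y
    obtain p1 where "h p1 > y" "p1 \<ge> 1"
      using linearizing_coordinate_unbounded[of m l G Q q y] \<open>m > 0\<close> \<open>l > 0\<close> m Q q(2)
      unfolding h_def by (metis diff_conv_add_uminus)
    \<comment> \<open>A value below \<open>y\<close> comes from the same growth estimate applied to
      the reflected data \<open>G (- s)\<close> and \<open>Q (- s)\<close>.\<close>
    have "((\<lambda>s. Q (- s)) has_real_derivative - q (- s)) (at s)" for s
      using Q[of "- s"] by (simp add: DERIV_mirror)
    moreover have "s * - q (- s) = l * G (- s) - 1" for s
      using q(2)[of "- s"] by simp
    ultimately obtain p2 where "p2 * exp (Q (- p2)) > - y" "p2 \<ge> 1"
      using linearizing_coordinate_unbounded[of m l "\<lambda>s. G (- s)" "\<lambda>s. Q (- s)" "\<lambda>s. - q (- s)" "- y"]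
        \<open>m > 0\<close> \<open>l > 0\<close> m by blast
    then have "h (- p2) < y"
      by (simp add: h_def)
    with \<open>h p1 > y\<close> \<open>p1 \<ge> 1\<close> \<open>p2 \<ge> 1\<close> show "\<exists>x. y = h x"
      using IVT'[of h "- p2" y p1] cont_h by force
  qed
  define k where "k = inv h"
  have kh: "k (h p) = p" "h (k w) = w" for p w
    using \<open>inj h\<close> \<open>surj h\<close> by (simp_all add: k_def surj_f_inv_f)
  have "continuous_on (range h) k"
    by (rule continuous_on_inverse_open) (simp_all add: cont_h kh)
  then have "continuous_on UNIV k"
    using \<open>surj h\<close> by simp
  note k = smooth_on_inverse_function[of h h' k, OF h' smooth_h' _ kh(2) this]
  show thesis
  proof (rule that[of k "\<lambda>w. inverse (h' (k w))"])
    show "bij k"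
      using \<open>inj h\<close> \<open>surj h\<close> by (simp add: k_def bij_imp_bij_inv bijI)
    show "(w / G 0) * inverse (h' (k w)) = k w / G (k w)" for w
    proof -
      have "w = k w * exp (Q (k w))"
        using kh(2)[of w] by (simp add: h_def)
      then have "(w / G 0) * inverse (h' (k w)) = (k w * exp (Q (k w)) / G 0) * inverse (h' (k w))"
        by simp
      also have "\<dots> = k w / G (k w)"
        using pos[of 0] pos[of "k w"] by (simp add: h'_def l_def field_simps)
      finally show ?thesis .
    qed
  qed (use k h'_pos in \<open>auto simp: less_imp_neq[symmetric]\<close>)
qed

section \<open>The profile curve\<close>

lemma vector_plane_inner: "vector [a, b] \<bullet> (vector [c, d] :: plane) = a * c + b * d"
  by (simp add: inner_vec_def sum_2)

lemma plane_decompose: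
  fixes e v z :: plane
  assumes "e \<bullet> e = 1" "v \<bullet> v = 1" "e \<bullet> v = 0"
  shows "z = (z \<bullet> e) *\<^sub>R e + (z \<bullet> v) *\<^sub>R v"
proof -
  have "e \<noteq> v"
    using assms by auto
  have "pairwise orthogonal {e, v}" "0 \<notin> {e, v}"
    using assms by (auto simp: pairwise_def orthogonal_def inner_commute)
  then have "independent {e, v}"
    by (rule pairwise_orthogonal_independent)
  then have "z \<in> span {e, v}"
    using card_ge_dim_independent[of "{e, v}" UNIV] \<open>e \<noteq> v\<close> by auto
  then obtain a b where "z = a *\<^sub>R e + b *\<^sub>R v"
    by (auto simp: span_insert span_singleton algebra_simps)
  then show ?thesis
    using assms by (simp add: inner_commute algebra_simps)
qed

text \<open>The coordinates \<open>a\<close> and \<open>b\<close> are arbitrary antiderivatives,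
  which leaves the translation of the curve free. The uniform bound \<open>m\<close> forces
  logarithmic growth of \<open>b\<close>. The function \<open>g\<close> enters only later, through
  \<open>G p = g (normal p)\<close>.\<close>

locale translator_profile =
  fixes e v :: plane and G :: "real \<Rightarrow> real" and m :: real and a b :: "real \<Rightarrow> real"
  assumes orthonormal: "e \<bullet> e = 1" "v \<bullet> v = 1" "e \<bullet> v = 0"
    and smooth_G: "smooth_on UNIV G"
    and m_pos: "m > 0" and m_le: "\<And>p. m \<le> G p"
    and a_deriv: "\<And>p. (a has_real_derivative G p / (1 + p\<^sup>2)) (at p)"
    and b_deriv: "\<And>p. (b has_real_derivative p * G p / (1 + p\<^sup>2)) (at p)"
begin

definition profile :: "real \<Rightarrow> plane" where
  "profile p = a p *\<^sub>R e + b p *\<^sub>R v"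

text \<open>Of the two unit normals to \<open>e + p *\<^sub>R v\<close> this is the one with
  negative \<open>v\<close>-component, as positivity of the speed \<open>- v \<bullet> N\<close>
  demands.\<close>

definition normal :: "real \<Rightarrow> plane" where
  "normal p = (1 / sqrt (1 + p\<^sup>2)) *\<^sub>R (p *\<^sub>R e - v)"

text \<open>With halfplanes instead of the set above the curve, closedness and convexity are
  immediate, and the halfplane of slope \<open>p\<close> shows which direction is outward at
  \<open>profile p\<close>. That the frontier is the curve then needs an argument.\<close>

definition region :: "plane set" where
  "region = (\<Inter>p. {z. normal p \<bullet> z \<le> normal p \<bullet> profile p})"

lemma G_pos: "G p > 0"
  using m_pos m_le[of p] by linarith

lemma one_plus_square_pos: "1 + p\<^sup>2 > (0::real)"
  by (simp add: add_pos_nonneg)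

lemma orthonormal': "v \<bullet> e = 0"
  using orthonormal by (simp add: inner_commute)

lemma inner_frame: "(x *\<^sub>R e + y *\<^sub>R v) \<bullet> e = x" "(x *\<^sub>R e + y *\<^sub>R v) \<bullet> v = y"
  by (simp_all add: inner_add_left orthonormal orthonormal')

lemma frame_eqI: "z \<bullet> e = z' \<bullet> e \<Longrightarrow> z \<bullet> v = z' \<bullet> v \<Longrightarrow> z = z'"
  using plane_decompose[OF orthonormal, of z] plane_decompose[OF orthonormal, of z'] by simp

lemma profile_inner: "profile p \<bullet> e = a p" "profile p \<bullet> v = b p"
  by (simp_all add: profile_def inner_frame)

lemma norm_normal: "norm (normal p) = 1"
proof -
  have "(norm (p *\<^sub>R e - v))\<^sup>2 = 1 + p\<^sup>2"
    by (simp add: power2_norm_eq_inner inner_diff_left inner_diff_right orthonormal orthonormal')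
       (simp add: power2_eq_square)
  then have "norm (p *\<^sub>R e - v) = sqrt (1 + p\<^sup>2)"
    by (metis norm_ge_zero real_sqrt_unique)
  then show ?thesis
    using one_plus_square_pos[of p] by (simp add: normal_def)
qed

lemma normal_inner: "normal p \<bullet> z = (p * (z \<bullet> e) - z \<bullet> v) / sqrt (1 + p\<^sup>2)"
  by (simp add: normal_def inner_diff_left inner_commute[of z] divide_inverse)

lemma strict_mono_a: "strict_mono a"
proof (rule strict_monoI)
  fix x y :: real
  assume "x < y"
  then show "a x < a y"
    by (rule DERIV_pos_imp_increasing)
       (auto intro!: exI a_deriv divide_pos_pos G_pos one_plus_square_pos)
qed

lemma continuous_a: "continuous_on S a" and continuous_b: "continuous_on S b"
  by (meson DERIV_isCont continuous_at_imp_continuous_on a_deriv b_deriv)+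

lemma continuous_profile: "continuous_on S profile"
  unfolding profile_def by (intro continuous_intros continuous_a continuous_b)

lemma inj_profile: "inj profile"
  by (rule injI) (metis profile_inner(1) strict_mono_a strict_mono_eq)

text \<open>As a function of \<open>q\<close>, the left-hand side has derivative
  \<open>(p - q) * G q / (1 + q^2)\<close>, so it increases before \<open>p\<close> and decreases
  after it. Geometrically, each tangent line meets the profile only at its point of contact.\<close>

lemma profile_strict_support:
  assumes "q \<noteq> p"
  shows "p * a q - b q < p * a p - b p"
proof -
  define F where "F q = p * a q - b q" for q
  have F': "(F has_real_derivative (p - s) * (G s / (1 + s\<^sup>2))) (at s)" for s
  proof -
    have eq: "p * (G s / (1 + s\<^sup>2)) - s * G s / (1 + s\<^sup>2) = (p - s) * (G s / (1 + s\<^sup>2))"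
      by (simp add: left_diff_distrib diff_divide_distrib)
    show ?thesis
      unfolding F_def eq[symmetric] by (rule DERIV_diff[OF DERIV_cmult[OF a_deriv] b_deriv])
  qed
  have pos: "G s / (1 + s\<^sup>2) > 0" for s
    using G_pos one_plus_square_pos by simp
  have cont: "continuous_on S F" for S
    by (meson DERIV_isCont continuous_at_imp_continuous_on F')
  consider "q < p" | "p < q"
    using assms by linarith
  then have "F q < F p"
  proof cases
    case 1
    have ex: "\<exists>y. (F has_real_derivative y) (at s) \<and> y > 0" if "q < s" "s < p" for s
      using pos[of s] that
      by (intro exI[of _ "(p - s) * (G s / (1 + s\<^sup>2))"] conjI F' mult_pos_pos) auto
    show ?thesis
      by (rule DERIV_pos_imp_increasing_open[OF 1 ex cont])
  next
    case 2
    have ex: "\<exists>y. (F has_real_derivative y) (at s) \<and> y < 0" if "p < s" "s < q" for s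
      using pos[of s] that
      by (intro exI[of _ "(p - s) * (G s / (1 + s\<^sup>2))"] conjI F' mult_neg_pos) auto
    show ?thesis
      by (rule DERIV_neg_imp_decreasing_open[OF 2 ex cont])
  qed
  then show ?thesis
    by (simp add: F_def)
qed

section \<open>The convex region above the profile\<close>

lemma in_region_iff: "z \<in> region \<longleftrightarrow> (\<forall>p. p * (z \<bullet> e) - z \<bullet> v \<le> p * a p - b p)"
proof -
  have "1 + p\<^sup>2 < (0::real) \<longleftrightarrow> False" for p
    using one_plus_square_pos[of p] by simp
  then show ?thesis
    by (simp add: region_def normal_inner profile_inner divide_le_cancel one_plus_square_pos)
qed

text \<open>The right-hand side is what \<open>b\<close> would be for constant \<open>G = m\<close>.
  The difference of the two has a derivative with the sign of its argument and is therefore smallest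
  at 0.\<close>

lemma b_lower_bound: "b p \<ge> b 0 + (m / 2) * ln (1 + p\<^sup>2)"
proof -
  define F where "F q = b q - (m / 2) * ln (1 + q\<^sup>2)" for q
  have F': "(F has_real_derivative s * ((G s - m) / (1 + s\<^sup>2))) (at s)" for s
  proof -
    have "((\<lambda>q. ln (1 + q\<^sup>2)) has_real_derivative 2 * s / (1 + s\<^sup>2)) (at s)"
      using one_plus_square_pos[of s] by (auto intro!: derivative_eq_intros)
    from DERIV_diff[OF b_deriv DERIV_cmult[OF this, of "m / 2"]] show ?thesis
      unfolding F_def by (simp add: diff_divide_distrib right_diff_distrib mult.commute)
  qed
  have pos: "(G s - m) / (1 + s\<^sup>2) \<ge> 0" for s
    using m_le[of s] one_plus_square_pos[of s] by simp
  have "F 0 \<le> F p"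
  proof (cases "p \<ge> 0")
    case True
    have "\<exists>y. (F has_real_derivative y) (at s) \<and> 0 \<le> y" if "0 \<le> s" for s
      using pos[of s] that by (intro exI[of _ "s * ((G s - m) / (1 + s\<^sup>2))"] conjI F' mult_nonneg_nonneg)
    then show ?thesis
      using DERIV_nonneg_imp_nondecreasing[OF True] by metis
  next
    case False
    have "\<exists>y. (F has_real_derivative y) (at s) \<and> y \<le> 0" if "s \<le> 0" for s
      using pos[of s] that by (intro exI[of _ "s * ((G s - m) / (1 + s\<^sup>2))"] conjI F' mult_nonpos_nonneg)
    with False show ?thesis
      using DERIV_nonpos_imp_nonincreasing[of p 0 F] by force
  qed
  then show ?thesis
    by (simp add: F_def)
qed

text \<open>A single \<open>p\<close> has to serve both ends of the profile, since the halfplanes of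
  slopes \<open>p\<close> and \<open>- p\<close> are used together. The growth comes from
  \<open>ln (1 + p^2) \<ge> 2 * ln p\<close>.\<close>

lemma b_unbounded:
  obtains p where "p \<ge> 1" "b p > B" "b (- p) > B"
proof -
  have "b 0 + m * ln p \<le> b p \<and> b 0 + m * ln p \<le> b (- p)" if "p \<ge> 1" for p
  proof -
    have "2 * ln p = ln (p\<^sup>2)"
      using that by (simp add: ln_realpow)
    also have "\<dots> \<le> ln (1 + p\<^sup>2)"
      using that one_plus_square_pos[of p] by (subst ln_le_cancel_iff) auto
    finally have "m * ln p \<le> (m / 2) * ln (1 + p\<^sup>2)"
      using m_pos mult_left_mono[of "2 * ln p" "ln (1 + p\<^sup>2)" "m / 2"] by simp
    with b_lower_bound[of p] b_lower_bound[of "- p"] show ?thesis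
      by simp
  qed
  then obtain p where "p \<ge> 1" "min (b p) (b (- p)) > B"
    using log_lower_bound_imp_unbounded[where F = "\<lambda>p. min (b p) (b (- p))" and c = m and d = "b 0"] m_pos
    by (metis min.bounded_iff)
  with that show thesis
    by simp
qed

text \<open>The range of \<open>a\<close> may be a bounded interval, so the region must be kept from
  leaving the strip over it. Once \<open>b p\<close> and \<open>b (- p)\<close> exceed the height of
  \<open>z\<close>, the halfplanes of slopes \<open>p\<close> and \<open>- p\<close> confine the
  abscissa to the interval from \<open>a (- p)\<close> to \<open>a p\<close>.\<close>

lemma region_abscissa:
  assumes "z \<in> region"
  shows "z \<bullet> e \<in> range a"
proof (rule ccontr)
  assume not_in: "z \<bullet> e \<notin> range a"
  have z: "p * (z \<bullet> e) - z \<bullet> v \<le> p * a p - b p" for p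
    using assms in_region_iff by blast
  obtain p where p: "p \<ge> 1" "b p > z \<bullet> v" "b (- p) > z \<bullet> v"
    using b_unbounded by blast
  have "p * (z \<bullet> e) < p * a p"
    using z[of p] p by linarith
  then have "z \<bullet> e < a p"
    using p by simp
  moreover have "p * a (- p) < p * (z \<bullet> e)"
    using z[of "- p"] p by (simp only: mult_minus_left)
  then have "a (- p) < z \<bullet> e"
    using p by simp
  ultimately obtain x where "a x = z \<bullet> e"
    using IVT'[of a "- p" "z \<bullet> e" p, OF _ _ _ continuous_a] p by force
  with not_in show False
    by (metis rangeI)
qed

text \<open>Invariance of domain: the set is the image of an open half-plane under the continuous
  injection \<open>\<Phi>\<close>.\<close>

lemma above_profile_open: "open {z. \<exists>p. z \<bullet> e = a p \<and> z \<bullet> v > b p}" (is "open ?U")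
proof -
  define \<Phi> :: "real \<times> real \<Rightarrow> plane" where "\<Phi> = (\<lambda>(p, s). profile p + s *\<^sub>R v)"
  have inner: "\<Phi> (p, s) \<bullet> e = a p" "\<Phi> (p, s) \<bullet> v = b p + s" for p s
    by (simp_all add: \<Phi>_def inner_add_left profile_inner orthonormal orthonormal')
  have "?U = \<Phi> ` (UNIV \<times> {0<..})"
  proof (intro equalityI subsetI)
    fix z
    assume "z \<in> ?U"
    then obtain p where "z \<bullet> e = a p" "z \<bullet> v > b p"
      by blast
    moreover from this have "z = \<Phi> (p, z \<bullet> v - b p)"
      by (intro frame_eqI) (simp_all add: inner)
    ultimately show "z \<in> \<Phi> ` (UNIV \<times> {0<..})"
      by force
  qed (auto simp: inner)
  moreover have "inj \<Phi>"
  proof (rule injI)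
    fix x y
    assume "\<Phi> x = \<Phi> y"
    then have "a (fst x) = a (fst y)" "b (fst x) + snd x = b (fst y) + snd y"
      by (metis inner prod.collapse)+
    then show "x = y"
      using strict_mono_eq[OF strict_mono_a] by (simp add: prod_eq_iff)
  qed
  moreover have "continuous_on S \<Phi>" for S
    unfolding \<Phi>_def case_prod_beta
    by (intro continuous_intros continuous_on_compose2[OF continuous_profile[of UNIV]]) auto
  ultimately show ?thesis
    using invariance_of_domain_gen[of "UNIV \<times> {0<..}" \<Phi>]
    by (simp add: open_Times inj_on_subset)
qed

lemma above_profile_in_region:
  assumes "z \<bullet> e = a p" "z \<bullet> v \<ge> b p"
  shows "z \<in> region"
  unfolding in_region_iff
proof
  fix q
  show "q * (z \<bullet> e) - z \<bullet> v \<le> q * a q - b q"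
    using profile_strict_support[of p q] assms by (cases "p = q") auto
qed

text \<open>Points strictly above the profile are interior. Any point of the region has some
  abscissa \<open>a p\<close>, and the halfplane of slope \<open>p\<close> puts it at or above
  \<open>profile p\<close>, so only profile points can be frontier points. Conversely, pushing
  \<open>profile p\<close> down along \<open>v\<close> leaves this halfplane.\<close>

lemma region_properties: "closed region" "convex region" "interior region \<noteq> {}"
  and frontier_region: "frontier region = range profile"
proof -
  show closed: "closed region"
    unfolding region_def by (intro closed_INT ballI closed_halfspace_le)
  show "convex region"
    unfolding region_def by (intro convex_INT convex_halfspace_le)
  have int: "z \<in> interior region" if "z \<bullet> e = a p" "z \<bullet> v > b p" for z p
    by (rule interiorI[OF above_profile_open]) (use that above_profile_in_region in force)+
  have "profile 0 + v \<in> interior region"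
    by (rule int[of _ 0]) (simp_all add: inner_add_left profile_inner orthonormal orthonormal')
  then show "interior region \<noteq> {}"
    by blast
  have "z \<in> range profile" if "z \<in> frontier region" for z
  proof -
    from that have z: "z \<in> region" "z \<notin> interior region"
      using closed by (auto simp: frontier_def)
    then obtain p where p: "z \<bullet> e = a p"
      using region_abscissa by blast
    with z(1) have "z \<bullet> v \<ge> b p"
      by (simp add: in_region_iff) (drule spec[of _ p], simp)
    with int[OF p] z(2) have "z \<bullet> v = b p"
      by linarith
    with p have "z = profile p"
      by (intro frame_eqI) (simp_all add: profile_inner)
    then show ?thesis
      by blast
  qed
  moreover have "profile p \<in> frontier region" for p
  proof -
    have "profile p \<notin> interior region"
    proof
      assume "profile p \<in> interior region"
      then obtain d where d: "d > 0" "ball (profile p) d \<subseteq> region"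
        by (auto simp: mem_interior)
      have "norm v = 1"
        by (simp add: norm_eq_sqrt_inner orthonormal)
      with d have "profile p - (d / 2) *\<^sub>R v \<in> region"
        by (intro subsetD[OF d(2)]) (simp add: dist_norm)
      with d(1) show False
        unfolding in_region_iff
        by (auto simp: inner_diff_left profile_inner orthonormal orthonormal' dest: spec[of _ p])
    qed
    moreover have "profile p \<in> region"
      by (rule above_profile_in_region[of _ p]) (simp_all add: profile_inner)
    ultimately show ?thesis
      using closed by (simp add: frontier_def)
  qed
  ultimately show "frontier region = range profile"
    by blast
qed

end

section \<open>Existence\<close>

lemma smooth_on_derivD:
  fixes f :: "real \<Rightarrow> real"
  assumes "smooth_on UNIV f" "\<And>x. (f has_real_derivative f' x) (at x)"
  shows "smooth_on UNIV f'"
proof -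
  obtain f'' where f'': "\<And>x. (f has_vector_derivative f'' x) (at x)" "smooth_on UNIV f''"
    using assms(1) unfolding smooth_on_real_iff[of f] by blast
  then have "f'' = f'"
    by (intro ext) (metis DERIV_unique assms(2) has_real_derivative_iff_has_vector_derivative)
  with f''(2) show ?thesis
    by simp
qed

text \<open>Differentiating the factor \<open>1 / norm (\<gamma>' u)\<close> of the unit tangent
  yields only a tangential term \<open>r *\<^sub>R \<gamma>' u\<close>, which is orthogonal to
  \<open>n\<close>. The value of \<open>r\<close> is thus never computed.\<close>

lemma curvature_eq:
  assumes \<gamma>': "\<And>u. (\<gamma> has_vector_derivative \<gamma>' u) (at u)"
    and \<gamma>'': "(\<gamma>' has_vector_derivative \<gamma>'') (at u)"
    and nz: "\<gamma>' u \<noteq> 0" and orth: "n \<bullet> \<gamma>' u = 0"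
  shows "curvature \<gamma> u n = - (\<gamma>'' \<bullet> n) / (norm (\<gamma>' u))\<^sup>2"
proof -
  have vd: "vector_derivative \<gamma> (at u) = \<gamma>' u" for u
    by (rule vector_derivative_at[OF \<gamma>'])
  have "unit_tangent \<gamma> = (\<lambda>u. inverse (norm (\<gamma>' u)) *\<^sub>R \<gamma>' u)"
    by (auto simp: unit_tangent_def vd sgn_div_norm)
  moreover have "(\<lambda>u. norm (\<gamma>' u)) differentiable at u"
    by (rule differentiable_compose[of norm \<gamma>'])
       (use nz differentiable_norm_at differentiableI_vector[OF \<gamma>''] in auto)
  then obtain r where "((\<lambda>u. inverse (norm (\<gamma>' u))) has_real_derivative r) (at u)"
    using DERIV_inverse_fun[of "\<lambda>u. norm (\<gamma>' u)" _ u UNIV] nz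
    by (auto simp: real_differentiable_def)
  ultimately have "(unit_tangent \<gamma> has_vector_derivative
      (inverse (norm (\<gamma>' u)) *\<^sub>R \<gamma>'' + r *\<^sub>R \<gamma>' u)) (at u)"
    using has_vector_derivative_scaleR[OF _ \<gamma>''] by simp
  then have "vector_derivative (unit_tangent \<gamma>) (at u) =
      inverse (norm (\<gamma>' u)) *\<^sub>R \<gamma>'' + r *\<^sub>R \<gamma>' u"
    by (rule vector_derivative_at)
  then show ?thesis
    using orth
    by (simp add: curvature_def vd inner_commute[of _ n] inner_add_right divide_inverse power2_eq_square)
qed

section \<open>The explicit translating solution\<close>

context translator_profile
begin

lemma profile_deriv:
  "(profile has_vector_derivative (G p / (1 + p\<^sup>2)) *\<^sub>R (e + p *\<^sub>R v)) (at p)"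
proof -
  have "((\<lambda>p. a p *\<^sub>R e + b p *\<^sub>R v) has_vector_derivative
      (G p / (1 + p\<^sup>2)) *\<^sub>R e + (p * G p / (1 + p\<^sup>2)) *\<^sub>R v) (at p)"
    by (auto intro!: derivative_eq_intros a_deriv b_deriv)
  then show ?thesis
    by (simp add: profile_def[abs_def] algebra_simps)
qed

lemma profile_compose_deriv:
  assumes "(P has_real_derivative P') (at u)"
  shows "((\<lambda>u. profile (P u)) has_vector_derivative
    (P' * G (P u) / (1 + (P u)\<^sup>2)) *\<^sub>R (e + P u *\<^sub>R v)) (at u)"
  using vector_diff_chain_at[OF assms[unfolded has_real_derivative_iff_has_vector_derivative] profile_deriv]
  by (simp add: o_def)

lemma smooth_a: "smooth_on UNIV a" and smooth_b: "smooth_on UNIV b"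
proof -
  have id: "smooth_on UNIV (\<lambda>p::real. p)"
    by (rule smooth_on_linear[OF bounded_linear_ident])
  have inv: "smooth_on UNIV (\<lambda>p::real. inverse (1 + p * p))"
    by (intro smooth_on_inverse smooth_on_add smooth_on_mult smooth_on_const id)
       (metis one_plus_square_pos power2_eq_square less_irrefl)
  show "smooth_on UNIV a"
    by (rule smooth_on_derivI[OF a_deriv])
       (use smooth_on_mult[OF smooth_G inv] in \<open>simp add: divide_inverse power2_eq_square\<close>)
  show "smooth_on UNIV b"
    by (rule smooth_on_derivI[OF b_deriv])
       (use smooth_on_mult[OF smooth_on_mult[OF id smooth_G] inv]
         in \<open>simp add: divide_inverse power2_eq_square\<close>)
qed

text \<open>Serves every time slice of the solution: at a fixed time, \<open>P\<close> is the slope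
  as a function of the label \<open>u\<close> and \<open>c\<close> is the displacement along
  \<open>v\<close>.\<close>

lemma profile_reparametrization:
  fixes P P' :: "real \<Rightarrow> real" and c :: plane
  assumes smooth_P: "smooth_on UNIV P" and P: "\<And>u. (P has_real_derivative P' u) (at u)"
    and P'_pos: "\<And>u. P' u > 0" and "surj P"
  defines "\<gamma> \<equiv> \<lambda>u. profile (P u) + c"
  shows "embedded_curve Real_Line \<gamma>"
    and "bounds_convex_region \<gamma> ((\<lambda>z. c + z) ` region)"
    and "is_outward_normal ((\<lambda>z. c + z) ` region) \<gamma> u (normal (P u))"
    and "curvature \<gamma> u (normal (P u)) = 1 / (G (P u) * sqrt (1 + (P u)\<^sup>2))"
proof -
  define \<sigma> where "\<sigma> u = P' u * G (P u) / (1 + (P u)\<^sup>2)" for u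
  have \<sigma>_pos: "\<sigma> u > 0" for u
    using P'_pos G_pos one_plus_square_pos by (simp add: \<sigma>_def)
  have \<gamma>': "(\<gamma> has_vector_derivative \<sigma> u *\<^sub>R (e + P u *\<^sub>R v)) (at u)" for u
    using profile_compose_deriv[OF P] unfolding \<gamma>_def \<sigma>_def
    by (auto intro!: derivative_eq_intros)
  have tangent_inner: "(e + q *\<^sub>R v) \<bullet> e = 1" "(e + q *\<^sub>R v) \<bullet> v = q" for q
    by (simp_all add: inner_add_left orthonormal orthonormal')
  then have tangent_nz: "e + q *\<^sub>R v \<noteq> 0" for q
    by (metis inner_zero_left zero_neq_one)
  have vd: "vector_derivative \<gamma> (at u) = \<sigma> u *\<^sub>R (e + P u *\<^sub>R v)" for u
    by (rule vector_derivative_at[OF \<gamma>'])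
  have "strict_mono P"
  proof (rule strict_monoI)
    fix x y :: real
    assume "x < y"
    then show "P x < P y"
      by (rule DERIV_pos_imp_increasing) (auto intro!: exI P P'_pos)
  qed
  have continuous_P: "continuous_on UNIV P"
    by (rule smooth_on_imp_continuous_on[OF smooth_P])
  show "embedded_curve Real_Line \<gamma>"
  proof -
    have "smooth_on UNIV \<gamma>"
      unfolding \<gamma>_def profile_def
      by (intro smooth_on_add smooth_on_scaleR smooth_on_const
          smooth_on_compose[OF smooth_a] smooth_on_compose[OF smooth_b] smooth_P)
    moreover have "\<sigma> u *\<^sub>R (e + P u *\<^sub>R v) \<noteq> 0" for u
      using \<sigma>_pos[of u] tangent_nz by simp
    moreover have "\<exists>h. homeomorphism UNIV (range \<gamma>) \<gamma> h"
    proof -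
      \<comment> \<open>The abscissa alone recovers the parameter: an injective continuous function
        on the line is a homeomorphism onto its range, and its inverse is composed with the
        projection to \<open>e\<close>.\<close>
      have "inj (\<lambda>u. a (P u))"
        using strict_mono_eq[OF strict_mono_a] strict_mono_eq[OF \<open>strict_mono P\<close>] by (simp add: inj_def)
      moreover have "continuous_on UNIV (\<lambda>u. a (P u))"
        by (intro continuous_on_compose2[OF continuous_a continuous_P]) auto
      ultimately obtain h where h: "homeomorphism UNIV (range (\<lambda>u. a (P u))) (\<lambda>u. a (P u)) h"
        using injective_into_1d_eq_homeomorphism[of UNIV "\<lambda>u. a (P u)"] by auto
      have inner: "(\<gamma> u - c) \<bullet> e = a (P u)" for u
        by (simp add: \<gamma>_def profile_inner)
      have "homeomorphism UNIV (range \<gamma>) \<gamma> (\<lambda>z. h ((z - c) \<bullet> e))"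
        unfolding homeomorphism_def
      proof (intro conjI)
        show "continuous_on UNIV \<gamma>"
          by (rule smooth_on_imp_continuous_on) fact
        show "continuous_on (range \<gamma>) (\<lambda>z. h ((z - c) \<bullet> e))"
        proof (rule continuous_on_compose2[of "range (\<lambda>u. a (P u))" h])
          show "continuous_on (range (\<lambda>u. a (P u))) h"
            using h by (simp add: homeomorphism_def)
        qed (auto simp: inner intro!: continuous_intros)
      qed (use h inner in \<open>auto simp: homeomorphism_def image_image\<close>)
      then show ?thesis
        by blast
    qed
    ultimately show ?thesis
      by (simp add: embedded_curve_def vd)
  qed
  have "range \<gamma> = (\<lambda>z. c + z) ` range profile"
  proof -
    have "\<gamma> = (\<lambda>z. c + z) \<circ> profile \<circ> P"
      by (simp add: \<gamma>_def fun_eq_iff)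
    then show ?thesis
      by (simp only: image_comp[symmetric] \<open>surj P\<close>)
  qed
  then show "bounds_convex_region \<gamma> ((\<lambda>z. c + z) ` region)"
    using region_properties
    by (simp add: bounds_convex_region_def closed_translation convex_translation
        interior_translation frontier_translation frontier_region)
  have orth: "normal q \<bullet> (e + q *\<^sub>R v) = 0" for q
    by (simp add: normal_inner tangent_inner)
  have "\<gamma> u + s *\<^sub>R normal (P u) \<notin> (\<lambda>z. c + z) ` region" if "s > 0" for s
  proof -
    have "normal q \<bullet> (profile q + s *\<^sub>R normal q) > normal q \<bullet> profile q" for q
      using that by (simp add: inner_add_right norm_normal flip: power2_norm_eq_inner)
    then have "profile (P u) + s *\<^sub>R normal (P u) \<notin> region"
      unfolding region_def by (auto simp: not_le)
    then show ?thesis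
      by (auto simp: \<gamma>_def algebra_simps)
  qed
  then show "is_outward_normal ((\<lambda>z. c + z) ` region) \<gamma> u (normal (P u))"
    by (simp add: is_outward_normal_def unit_tangent_def vd norm_normal sgn_div_norm orth)
  have "smooth_on UNIV \<sigma>"
    unfolding \<sigma>_def divide_inverse power2_eq_square
    by (intro smooth_on_mult smooth_on_inverse smooth_on_add smooth_on_const smooth_P
        smooth_on_derivD[OF smooth_P P] smooth_on_compose[OF smooth_G])
       (metis one_plus_square_pos power2_eq_square less_irrefl)
  \<comment> \<open>Only the existence of \<open>\<sigma>'\<close> matters: its term in the second
    derivative is tangential and drops out of the curvature.\<close>
  then obtain \<sigma>' where \<sigma>': "\<And>u. (\<sigma> has_real_derivative \<sigma>' u) (at u)"
    unfolding smooth_on_real_iff[of \<sigma>] has_real_derivative_iff_has_vector_derivative by blast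
  have \<gamma>'': "((\<lambda>u. \<sigma> u *\<^sub>R (e + P u *\<^sub>R v)) has_vector_derivative
      \<sigma> u *\<^sub>R (P' u *\<^sub>R v) + \<sigma>' u *\<^sub>R (e + P u *\<^sub>R v)) (at u)"
    by (auto intro!: derivative_eq_intros \<sigma>' P)
  have "(norm (e + q *\<^sub>R v))\<^sup>2 = 1 + q\<^sup>2" for q
    by (simp add: power2_norm_eq_inner inner_add_right tangent_inner) (simp add: power2_eq_square)
  then have norm_\<gamma>': "(norm (\<sigma> u *\<^sub>R (e + P u *\<^sub>R v)))\<^sup>2 = (\<sigma> u)\<^sup>2 * (1 + (P u)\<^sup>2)"
    by (simp add: power_mult_distrib)
  have "curvature \<gamma> u (normal (P u)) =
    - ((\<sigma> u *\<^sub>R (P' u *\<^sub>R v) + \<sigma>' u *\<^sub>R (e + P u *\<^sub>R v)) \<bullet> normal (P u)) /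
      (norm (\<sigma> u *\<^sub>R (e + P u *\<^sub>R v)))\<^sup>2"
    using \<sigma>_pos[of u] tangent_nz by (intro curvature_eq \<gamma>' \<gamma>'') (simp_all add: orth)
  also have "\<dots> = (\<sigma> u * P' u / sqrt (1 + (P u)\<^sup>2)) / ((\<sigma> u)\<^sup>2 * (1 + (P u)\<^sup>2))"
    unfolding norm_\<gamma>'
    by (simp add: inner_add_left inner_commute[of _ "normal (P u)"] orth normal_inner orthonormal orthonormal')
  also have "\<dots> = 1 / (G (P u) * sqrt (1 + (P u)\<^sup>2))"
  proof -
    have "(s * x / r) / (s\<^sup>2 * w) = 1 / (y * r)"
      if "s = x * y / w" "x > 0" "y > 0" "w > 0" "r > 0" for s x r w y :: real
    proof -
      have "s > 0"
        using that by simp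
      with that show ?thesis
        by (simp add: field_simps power2_eq_square)
    qed
    from this[OF \<sigma>_def P'_pos G_pos one_plus_square_pos] show ?thesis
      using one_plus_square_pos[of "P u"] by simp
  qed
  finally show "curvature \<gamma> u (normal (P u)) = 1 / (G (P u) * sqrt (1 + (P u)\<^sup>2))" .
qed

lemma exists_translator:
  assumes g: "\<And>p. G p = g (normal p)"
  shows "\<exists>\<Gamma>. acsf_translator g v 1 \<Gamma>"
proof -
  obtain k k' where smooth_k: "smooth_on UNIV k" and "bij k"
    and k: "\<And>w. (k has_real_derivative k' w) (at w)" and k'_pos: "\<And>w. k' w > 0"
    and k_flow: "\<And>w. (w / G 0) * k' w = k w / G (k w)"
    using linearizing_coordinate[OF smooth_G m_pos m_le] by blast
  \<comment> \<open>Normal motion means that \<open>p' * G p / (1 + p^2)\<close> times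
    \<open>e + p *\<^sub>R v\<close>, plus \<open>v\<close>, is orthogonal to
    \<open>e + p *\<^sub>R v\<close>, which amounts to \<open>p' = - p / G p\<close>. In the
    linearising coordinate the solution starting at \<open>u\<close> is
    \<open>u * exp (- (t / G 0))\<close>.\<close>
  define X where "X u t = profile (k (u * exp (- (t / G 0)))) + t *\<^sub>R v" for u t
  have surj: "surj (\<lambda>u. k (u * exp (- (t / G 0))))" for t
  proof -
    have "\<exists>u. y = k (u * exp (- (t / G 0)))" for y
      using bij_is_surj[OF \<open>bij k\<close>]
      by (intro exI[of _ "inv k y * exp (t / G 0)"]) (simp add: mult.assoc surj_f_inv_f flip: exp_add)
    then show ?thesis
      by (simp add: surj_def)
  qed
  have P: "((\<lambda>u. k (u * exp (- (t / G 0)))) has_real_derivative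
      k' (u * exp (- (t / G 0))) * exp (- (t / G 0))) (at u)" for u t
    by (auto intro!: derivative_eq_intros DERIV_chain2[OF k])
  have smooth_P: "smooth_on UNIV (\<lambda>u. k (u * exp (- (t / G 0))))" for t
    by (intro smooth_on_compose[OF smooth_k] smooth_on_mult smooth_on_const smooth_on_linear[OF bounded_linear_ident])
  define K where "K t = (\<lambda>z. t *\<^sub>R v + z) ` region" for t
  define p where "p u t = k (u * exp (- (t / G 0)))" for u t
  have slice: "embedded_curve Real_Line (\<lambda>u. X u t)" "bounds_convex_region (\<lambda>u. X u t) (K t)"
      "is_outward_normal (K t) (\<lambda>u. X u t) u (normal (p u t))"
      "curvature (\<lambda>u. X u t) u (normal (p u t)) = 1 / (G (p u t) * sqrt (1 + (p u t)\<^sup>2))" for u t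
    unfolding X_def K_def p_def
    by (rule profile_reparametrization[OF smooth_P P _ surj]; use k'_pos in simp)+
  have smooth_X: "smooth_on UNIV (\<lambda>(u, t). X u t)"
  proof -
    have "smooth_on UNIV (\<lambda>x::real \<times> real. k (fst x * exp ((- (1 / G 0)) * snd x)))" (is "smooth_on UNIV ?\<phi>")
      by (intro smooth_on_compose[OF smooth_k] smooth_on_mult smooth_on_const smooth_on_compose[OF smooth_on_exp]
          smooth_on_linear[OF bounded_linear_fst] smooth_on_linear[OF bounded_linear_snd])
    then have "smooth_on UNIV (\<lambda>x. a (?\<phi> x) *\<^sub>R e + b (?\<phi> x) *\<^sub>R v + snd x *\<^sub>R v)"
      by (intro smooth_on_add smooth_on_scaleR smooth_on_const smooth_on_compose[OF smooth_a]
          smooth_on_compose[OF smooth_b] smooth_on_linear[OF bounded_linear_snd])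
    then show ?thesis
      by (simp add: X_def profile_def case_prod_unfold)
  qed
  have velocity: "((\<lambda>s. X u s) has_vector_derivative
      (- (g n * (1 / (G p * sqrt (1 + p\<^sup>2))))) *\<^sub>R n) (at t)"
    if "p = k (u * exp (- (t / G 0)))" "n = normal p" for u t p n
  proof -
    have "((\<lambda>t. u * exp (- (t / G 0))) has_real_derivative - (u * exp (- (t / G 0)) / G 0)) (at t)"
      using G_pos[of 0] by (auto intro!: derivative_eq_intros)
    note DERIV_chain2[OF k this]
    moreover have "k' (u * exp (- (t / G 0))) * - (u * exp (- (t / G 0)) / G 0) = - (p / G p)"
      using k_flow[of "u * exp (- (t / G 0))"] that by (simp add: algebra_simps)
    ultimately have "((\<lambda>t. k (u * exp (- (t / G 0)))) has_real_derivative - (p / G p)) (at t)"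
      by simp
    from profile_compose_deriv[OF this, folded that(1)]
    have "((\<lambda>s. X u s) has_vector_derivative
        (- (p / G p) * G p / (1 + p\<^sup>2)) *\<^sub>R (e + p *\<^sub>R v) + v) (at t)"
      unfolding X_def by (auto intro!: derivative_eq_intros)
    \<comment> \<open>Subtracting from \<open>v\<close> its tangential part leaves its normal part,
      which is the prescribed normal velocity.\<close>
    moreover have "(- (p / G p) * G p / (1 + p\<^sup>2)) *\<^sub>R (e + p *\<^sub>R v) + v =
        (- (g n * (1 / (G p * sqrt (1 + p\<^sup>2))))) *\<^sub>R n"
    proof -
      have "- (p / G p) * G p / (1 + p\<^sup>2) = - (p / (1 + p\<^sup>2))"
        using G_pos[of p] by simp
      moreover have "(- (g n * (1 / (G p * sqrt (1 + p\<^sup>2))))) *\<^sub>R n =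
          (- (1 / (1 + p\<^sup>2))) *\<^sub>R (p *\<^sub>R e - v)"
        unfolding that(2) g[symmetric] using G_pos[of p] one_plus_square_pos[of p]
        by (simp add: normal_def)
      moreover have "(- (p / (1 + p\<^sup>2))) *\<^sub>R (e + p *\<^sub>R v) + v = (- (1 / (1 + p\<^sup>2))) *\<^sub>R (p *\<^sub>R e - v)"
        using one_plus_square_pos[of p]
        by (intro frame_eqI)
           (simp_all add: inner_add_left inner_diff_left orthonormal orthonormal' field_simps power2_eq_square)
      ultimately show ?thesis
        by (simp only:)
    qed
    ultimately show ?thesis
      by simp
  qed
  have curvature_pos: "1 / (G p * sqrt (1 + p\<^sup>2)) > 0" for p
    using G_pos[of p] one_plus_square_pos[of p] by simp
  have "acsf_solution g Real_Line UNIV X"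
    unfolding acsf_solution_def
  proof (intro conjI ballI)
    fix t
    show "embedded_curve Real_Line (\<lambda>u. X u t)"
      by (rule slice)
    have "\<exists>n. is_outward_normal (K t) (\<lambda>u. X u t) u n \<and> curvature (\<lambda>u. X u t) u n > 0 \<and>
        (X u has_vector_derivative - (g n * curvature (\<lambda>u. X u t) u n) *\<^sub>R n) (at t within UNIV)" for u
      by (intro exI[of _ "normal (p u t)"] conjI)
         (simp_all only: slice curvature_pos velocity[OF p_def refl])
    then show "\<exists>K. bounds_convex_region (\<lambda>u. X u t) K \<and>
        (\<forall>u. \<exists>n. is_outward_normal K (\<lambda>u. X u t) u n \<and> curvature (\<lambda>u. X u t) u n > 0 \<and>
        (X u has_vector_derivative - (g n * curvature (\<lambda>u. X u t) u n) *\<^sub>R n) (at t within UNIV))"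
      using slice(2) by blast
  qed (use smooth_X in simp_all)
  then have flow: "acsf_flow g UNIV (\<lambda>t. range (\<lambda>u. X u t))"
    unfolding acsf_flow_def by blast
  have range_X: "range (\<lambda>u. X u t) = (\<lambda>x. x + t *\<^sub>R v) ` range profile" for t
  proof -
    have "(\<lambda>u. X u t) = (\<lambda>x. x + t *\<^sub>R v) \<circ> profile \<circ> (\<lambda>u. k (u * exp (- (t / G 0))))"
      by (simp add: X_def fun_eq_iff)
    then show ?thesis
      by (simp only: image_comp[symmetric] surj)
  qed
  have "acsf_translator g v 1 (\<lambda>t. range (\<lambda>u. X u t))"
    unfolding acsf_translator_def
  proof (intro conjI allI)
    show "range (\<lambda>u. X u t) = (\<lambda>x. x + (1 * t) *\<^sub>R v) ` range (\<lambda>u. X u 0)" for t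
      unfolding range_X by (simp add: image_image)
  qed (simp_all add: flow norm_eq_sqrt_inner orthonormal)
  then show ?thesis
    by blast
qed

end

section \<open>Uniqueness\<close>

lemma inner_const_deriv:
  "(f has_vector_derivative f') (at u) \<Longrightarrow> ((\<lambda>u. f u \<bullet> n) has_real_derivative f' \<bullet> n) (at u)"
  unfolding has_real_derivative_iff_has_vector_derivative
  by (rule bounded_linear.has_vector_derivative[OF bounded_linear_inner_left])

text \<open>Since \<open>f' u = 0\<close> and \<open>D < 0\<close>, \<open>f'\<close> is negative on
  a short interval to the right of \<open>u\<close>, so \<open>f\<close> strictly decreases
  there.\<close>

lemma not_minimum_if_concave:
  fixes f f' :: "real \<Rightarrow> real"
  assumes f: "\<And>u. (f has_real_derivative f' u) (at u)" and f': "(f' has_real_derivative D) (at u)"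
    and "f' u = 0" "D < 0"
  shows "\<exists>w. f w < f u"
proof -
  obtain d where d: "d > 0" "\<And>h. 0 < h \<Longrightarrow> h < d \<Longrightarrow> f' (u + h) < f' u"
    using DERIV_neg_dec_right[OF f' \<open>D < 0\<close>] by blast
  have neg: "\<exists>y. (f has_real_derivative y) (at x) \<and> y < 0" if "u < x" "x < u + d / 2" for x
    using f[of x] d(2)[of "x - u"] that d(1) \<open>f' u = 0\<close> by (intro exI[of _ "f' x"]) auto
  have "continuous_on {u..u + d / 2} f"
    by (meson DERIV_isCont continuous_at_imp_continuous_on f)
  then have "f (u + d / 2) < f u"
    using DERIV_neg_imp_decreasing_open[OF _ neg] d(1) by simp
  then show ?thesis ..
qed

text \<open>Positive curvature forces the inner normal of a supporting line to be \<open>- n\<close>.\<close>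

lemma convex_curve_support:
  fixes \<gamma> \<gamma>' :: "real \<Rightarrow> plane"
  assumes K: "bounds_convex_region \<gamma> K"
    and \<gamma>': "\<And>u. (\<gamma> has_vector_derivative \<gamma>' u) (at u)"
    and \<gamma>'': "(\<gamma>' has_vector_derivative \<gamma>'') (at u)"
    and nz: "\<gamma>' u \<noteq> 0" and n: "norm n = 1" "n \<bullet> \<gamma>' u = 0" and concave: "\<gamma>'' \<bullet> n < 0"
    and z: "z \<in> K"
  shows "z \<bullet> n \<le> \<gamma> u \<bullet> n"
proof -
  have on_frontier: "\<gamma> w \<in> frontier K" for w
    using K by (simp add: bounds_convex_region_def)
  have closure: "closure K = K"
    using K by (simp add: bounds_convex_region_def)
  have "\<gamma> u \<in> closure K" "\<gamma> u \<notin> rel_interior K"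
    using on_frontier[of u] K
    by (auto simp: frontier_def bounds_convex_region_def rel_interior_nonempty_interior)
  then obtain x where x: "x \<noteq> 0" "\<And>y. y \<in> K \<Longrightarrow> x \<bullet> \<gamma> u \<le> x \<bullet> y"
    using supporting_hyperplane_relative_frontier[of K "\<gamma> u"] K closure
    by (metis bounds_convex_region_def)
  have in_K: "\<gamma> w \<in> K" for w
    using on_frontier[of w] closure by (simp add: frontier_def)
  have support: "\<gamma> u \<bullet> x \<le> y \<bullet> x" if "y \<in> K" for y
    using x(2)[OF that] by (simp add: inner_commute)
  \<comment> \<open>The curve stays in \<open>K\<close>, so its \<open>x\<close>-component is
    minimal at \<open>u\<close>. Hence \<open>x\<close> is orthogonal to the tangent and is a
    multiple of \<open>n\<close>.\<close>
  have "\<gamma>' u \<bullet> x = 0"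
    by (rule DERIV_local_min[OF inner_const_deriv[OF \<gamma>'], of 1]) (auto simp: support in_K)
  define T where "T = sgn (\<gamma>' u)"
  have "T \<bullet> T = 1"
    using nz by (simp add: T_def norm_sgn flip: power2_norm_eq_inner)
  moreover have "n \<bullet> n = 1" "T \<bullet> n = 0" "T \<bullet> x = 0"
    using n \<open>\<gamma>' u \<bullet> x = 0\<close> by (simp_all add: T_def sgn_div_norm inner_commute flip: power2_norm_eq_inner)
  ultimately have x_eq: "x = (x \<bullet> n) *\<^sub>R n"
    using plane_decompose[of T n x] by (simp add: inner_commute)
  have "y \<bullet> x = (x \<bullet> n) * (y \<bullet> n)" for y
    using arg_cong[OF x_eq, of "\<lambda>x. y \<bullet> x"] by simp
  with support have support_n: "(x \<bullet> n) * (\<gamma> u \<bullet> n) \<le> (x \<bullet> n) * (y \<bullet> n)" if "y \<in> K" for y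
    using that by metis
  have "x \<bullet> n < 0"
  proof (rule ccontr)
    assume "\<not> x \<bullet> n < 0"
    with x(1) x_eq have "x \<bullet> n > 0"
      by (metis linorder_neqE_linordered_idom scaleR_zero_left)
    \<comment> \<open>If \<open>x\<close> were a positive multiple of \<open>n\<close>, then
      \<open>\<gamma> \<bullet> n\<close> would be minimal at \<open>u\<close>, against the negative
      second derivative.\<close>
    obtain w where "\<gamma> w \<bullet> n < \<gamma> u \<bullet> n"
      using not_minimum_if_concave[OF inner_const_deriv[OF \<gamma>'] inner_const_deriv[OF \<gamma>''] _ concave] n(2)
      by (auto simp: inner_commute)
    with support_n[OF in_K[of w]] show False
      using \<open>x \<bullet> n > 0\<close> by simp
  qed
  with support_n[OF z] show ?thesis
    by simp
qed

section \<open>Rigidity of the time slice of a translator\<close>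

context translator_profile
begin

text \<open>The speed equation turns into a first-order relation between the slope and the abscissa,
  which makes \<open>\<gamma>\<close> and \<open>profile\<close> composed with the slope differ by a
  constant. Closedness of the curve then excludes that only a part of the profile is traced.\<close>

lemma translating_curve_is_profile:
  fixes \<gamma> \<gamma>' \<gamma>'' :: "real \<Rightarrow> plane"
  assumes \<gamma>': "\<And>u. (\<gamma> has_vector_derivative \<gamma>' u) (at u)"
    and \<gamma>'': "\<And>u. (\<gamma>' has_vector_derivative \<gamma>'' u) (at u)"
    and nz: "\<And>u. \<gamma>' u \<noteq> 0" and closed: "closed (range \<gamma>)"
    and g: "\<And>p. G p = g (normal p)"
    and n: "\<And>u. norm (n u) = 1" "\<And>u. n u \<bullet> \<gamma>' u = 0" "\<And>u. v \<bullet> n u < 0"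
    and speed: "\<And>u. g (n u) * (\<gamma>'' u \<bullet> n u) / (norm (\<gamma>' u))\<^sup>2 = v \<bullet> n u"
  shows "\<exists>c. range \<gamma> = (\<lambda>x. x + c) ` range profile"
proof -
  have decompose: "z \<bullet> z' = (z \<bullet> e) * (z' \<bullet> e) + (z \<bullet> v) * (z' \<bullet> v)" for z z'
  proof -
    have "z \<bullet> z' = ((z \<bullet> e) *\<^sub>R e + (z \<bullet> v) *\<^sub>R v) \<bullet> z'"
      using plane_decompose[OF orthonormal, of z] by simp
    then show ?thesis
      by (simp only: inner_add_left inner_scaleR_left inner_commute[of e z'] inner_commute[of v z'])
  qed
  \<comment> \<open>If the tangent were parallel to \<open>v\<close>, the normal would be orthogonal
    to \<open>v\<close>, against \<open>v \<bullet> n u < 0\<close>. So the slope is finite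
    everywhere.\<close>
  have x'_nz: "\<gamma>' u \<bullet> e \<noteq> 0" for u
  proof
    assume 0: "\<gamma>' u \<bullet> e = 0"
    have "\<gamma>' u \<bullet> v \<noteq> 0"
      using nz[of u] 0 by (metis frame_eqI inner_zero_left)
    with 0 show False
      using n(2,3)[of u] decompose[of "n u" "\<gamma>' u"] by (simp add: inner_commute)
  qed
  define p where "p u = (\<gamma>' u \<bullet> v) / (\<gamma>' u \<bullet> e)" for u
  have y': "\<gamma>' u \<bullet> v = p u * (\<gamma>' u \<bullet> e)" for u
    using x'_nz by (simp add: p_def)
  have n_eq: "n u = normal (p u)" for u
  proof -
    \<comment> \<open>Orthogonality to the tangent fixes \<open>n u\<close> up to the factor
      \<open>r\<close>; its sign comes from \<open>v \<bullet> n u < 0\<close> and its size from the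
      unit length.\<close>
    define r where "r = - (n u \<bullet> v)"
    have "r > 0"
      using n(3)[of u] by (simp add: r_def inner_commute)
    have "(n u \<bullet> e) * (\<gamma>' u \<bullet> e) = r * p u * (\<gamma>' u \<bullet> e)"
      using n(2)[of u] decompose[of "n u" "\<gamma>' u"] y'[of u] by (simp add: r_def)
    then have ne: "n u \<bullet> e = r * p u"
      using x'_nz[of u] by simp
    have "1 = n u \<bullet> n u"
      using n(1)[of u] by (simp flip: power2_norm_eq_inner)
    also have "\<dots> = r\<^sup>2 * (1 + (p u)\<^sup>2)"
      using decompose[of "n u" "n u"] ne by (simp add: r_def algebra_simps power2_eq_square)
    finally have "(r * sqrt (1 + (p u)\<^sup>2))\<^sup>2 = 1"
      using one_plus_square_pos[of "p u"] by (simp add: power_mult_distrib)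
    then have "r * sqrt (1 + (p u)\<^sup>2) = 1"
      using \<open>r > 0\<close> one_plus_square_pos[of "p u"] by (simp add: power2_eq_1_iff)
         (smt (verit) mult_pos_pos real_sqrt_gt_zero)
    then have r: "r = 1 / sqrt (1 + (p u)\<^sup>2)"
      by (metis eq_divide_eq mult_zero_right zero_neq_one)
    show ?thesis
    proof (rule frame_eqI)
      show "n u \<bullet> e = normal (p u) \<bullet> e"
        using ne r by (simp add: normal_inner orthonormal orthonormal')
      show "n u \<bullet> v = normal (p u) \<bullet> v"
        using r by (simp add: r_def normal_inner orthonormal orthonormal')
    qed
  qed
  have slope_eq: "G (p u) * (\<gamma>'' u \<bullet> v - p u * (\<gamma>'' u \<bullet> e)) = (\<gamma>' u \<bullet> e)\<^sup>2 * (1 + (p u)\<^sup>2)" for u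
  proof -
    have norm: "(norm (\<gamma>' u))\<^sup>2 = (\<gamma>' u \<bullet> e)\<^sup>2 * (1 + (p u)\<^sup>2)"
      using decompose[of "\<gamma>' u" "\<gamma>' u"]
      by (simp only: power2_norm_eq_inner y') (simp add: algebra_simps power2_eq_square)
    have "G (p u) * (\<gamma>'' u \<bullet> n u) = (v \<bullet> n u) * (norm (\<gamma>' u))\<^sup>2"
      using speed[of u] nz[of u] by (simp add: g n_eq[symmetric] divide_eq_eq)
    moreover have "\<gamma>'' u \<bullet> n u = (p u * (\<gamma>'' u \<bullet> e) - \<gamma>'' u \<bullet> v) / sqrt (1 + (p u)\<^sup>2)"
      unfolding n_eq inner_commute[of "\<gamma>'' u" "normal (p u)"] by (rule normal_inner)
    moreover have "v \<bullet> n u = - 1 / sqrt (1 + (p u)\<^sup>2)"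
      unfolding n_eq inner_commute[of v "normal (p u)"] by (simp add: normal_inner orthonormal orthonormal')
    ultimately have "G (p u) * ((p u * (\<gamma>'' u \<bullet> e) - \<gamma>'' u \<bullet> v) / sqrt (1 + (p u)\<^sup>2)) =
        (- 1 / sqrt (1 + (p u)\<^sup>2)) * ((\<gamma>' u \<bullet> e)\<^sup>2 * (1 + (p u)\<^sup>2))"
      by (simp only: norm)
    moreover have "x * (z - q * y) = w"
      if "x * ((q * y - z) / r) = (- 1 / r) * w" "r > 0" for x y z q r w :: real
    proof -
      have "r * (x * (z - q * y)) = r * w"
        using that by (simp add: field_simps)
      with that(2) show ?thesis
        by simp
    qed
    moreover have "sqrt (1 + (p u)\<^sup>2) > 0"
      using one_plus_square_pos[of "p u"] by simp
    ultimately show ?thesis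
      by blast
  qed
  \<comment> \<open>By the quotient rule the derivative of the slope is \<open>(\<gamma>'' u
    \<bullet> v - p u * (\<gamma>'' u \<bullet> e)) / (\<gamma>' u \<bullet> e)\<close>, and
    \<open>slope_eq\<close> eliminates the second derivatives. This value gives
    \<open>profile (p u)\<close> the same derivative as \<open>\<gamma> u\<close>.\<close>
  define p' where "p' u = (\<gamma>' u \<bullet> e) * (1 + (p u)\<^sup>2) / G (p u)" for u
  have p': "(p has_real_derivative p' u) (at u)" for u
  proof -
    have "(p has_real_derivative
        ((\<gamma>'' u \<bullet> v) * (\<gamma>' u \<bullet> e) - (\<gamma>' u \<bullet> v) * (\<gamma>'' u \<bullet> e)) / ((\<gamma>' u \<bullet> e) * (\<gamma>' u \<bullet> e))) (at u)"
      unfolding p_def by (rule DERIV_divide[OF inner_const_deriv[OF \<gamma>''] inner_const_deriv[OF \<gamma>''] x'_nz])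
    moreover have "((\<gamma>'' u \<bullet> v) * (\<gamma>' u \<bullet> e) - (\<gamma>' u \<bullet> v) * (\<gamma>'' u \<bullet> e)) / ((\<gamma>' u \<bullet> e) * (\<gamma>' u \<bullet> e)) = p' u"
    proof -
      have "\<gamma>'' u \<bullet> v - p u * (\<gamma>'' u \<bullet> e) = (\<gamma>' u \<bullet> e) * p' u"
        using slope_eq[of u] G_pos[of "p u"]
        by (simp add: p'_def eq_divide_eq power2_eq_square mult.assoc mult.commute[of "G (p u)"])
      moreover have "(\<gamma>'' u \<bullet> v) * (\<gamma>' u \<bullet> e) - (\<gamma>' u \<bullet> v) * (\<gamma>'' u \<bullet> e) =
          (\<gamma>' u \<bullet> e) * (\<gamma>'' u \<bullet> v - p u * (\<gamma>'' u \<bullet> e))"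
        by (simp add: y' algebra_simps)
      ultimately show ?thesis
        using x'_nz[of u] by simp
    qed
    ultimately show ?thesis
      by simp
  qed
  have p'_nz: "p' u \<noteq> 0" for u
    using x'_nz[of u] G_pos[of "p u"] one_plus_square_pos[of "p u"] by (simp add: p'_def)
  have "((\<lambda>u. \<gamma> u - profile (p u)) has_vector_derivative 0) (at u within UNIV)" for u
  proof -
    have "p' u * G (p u) / (1 + (p u)\<^sup>2) = \<gamma>' u \<bullet> e"
      using G_pos[of "p u"] one_plus_square_pos[of "p u"] by (simp add: p'_def)
    then have "((\<lambda>u. profile (p u)) has_vector_derivative (\<gamma>' u \<bullet> e) *\<^sub>R (e + p u *\<^sub>R v)) (at u)"
      using profile_compose_deriv[OF p', of u] by simp
    moreover have "(\<gamma>' u \<bullet> e) *\<^sub>R (e + p u *\<^sub>R v) = \<gamma>' u"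
      by (rule frame_eqI) (simp_all add: inner_add_left orthonormal orthonormal' y')
    ultimately show ?thesis
      using has_vector_derivative_diff[OF \<gamma>'] by fastforce
  qed
  then obtain c where "\<And>u. u \<in> UNIV \<Longrightarrow> \<gamma> u - profile (p u) = c"
    using has_vector_derivative_zero_constant[OF convex_UNIV, where f = "\<lambda>u. \<gamma> u - profile (p u)"]
    by metis
  then have \<gamma>_eq: "\<gamma> u = profile (p u) + c" for u
    by (simp add: diff_eq_eq add.commute)
  have continuous_p: "continuous_on S p" for S
    by (meson DERIV_isCont continuous_at_imp_continuous_on p')
  \<comment> \<open>By Rolle's theorem \<open>p\<close> is injective, since its derivative never
    vanishes. An injective continuous function on the line is open.\<close>
  have "u1 = u2" if "p u1 = p u2" for u1 u2
  proof -
    have "\<not> (u1 < u2)" if "p u1 = p u2" for u1 u2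
    proof
      assume "u1 < u2"
      have "\<exists>u>u1. u < u2 \<and> (p has_real_derivative 0) (at u)"
        by (rule Rolle[OF \<open>u1 < u2\<close> that continuous_p]) (meson p' real_differentiable_def)
      then show False
        using DERIV_unique[OF p'] p'_nz by blast
    qed
    from this[of u1 u2] this[of u2 u1] that show ?thesis
      by force
  qed
  then have "open (range p)"
    using injective_into_1d_imp_open_map_UNIV[of UNIV UNIV p] continuous_p by (simp add: inj_def)
  \<comment> \<open>Because \<open>profile\<close> is injective, a slope is attained exactly when
    the corresponding profile point lies on the curve; this carries closedness over to
    \<open>range p\<close>.\<close>
  moreover have range_p: "range p = (\<lambda>s. profile s + c) -` range \<gamma>"
    by (auto simp: \<gamma>_eq inj_eq[OF inj_profile])
  have "closed (range p)"
    unfolding range_p by (intro closed_vimage[OF closed] continuous_intros continuous_profile)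
  ultimately have "range p = UNIV"
    using clopen[of "range p"] by blast
  moreover have "\<gamma> = (\<lambda>x. x + c) \<circ> profile \<circ> p"
    by (simp add: \<gamma>_eq fun_eq_iff)
  ultimately have "range \<gamma> = (\<lambda>x. x + c) ` range profile"
    by (simp only: image_comp[symmetric])
  then show ?thesis
    by blast
qed

text \<open>Nothing is known about which point of the initial slice
  \<open>X u t - t *\<^sub>R v\<close> is, only that it belongs to \<open>K\<close>. Support of
  \<open>K\<close> along \<open>n u\<close> is enough to extract the normal speed, so no
  reparametrization of the flow has to be constructed.\<close>

lemma translator_slice:
  assumes g: "\<And>p. G p = g (normal p)" and g_pos: "\<And>n. norm n = 1 \<Longrightarrow> g n > 0"
    and "acsf_translator g v 1 \<Gamma>"
  shows "\<exists>c. \<Gamma> 0 = (\<lambda>x. x + c) ` range profile"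
proof -
  have "acsf_flow g UNIV \<Gamma>" and translates: "\<And>t. \<Gamma> t = (\<lambda>x. x + (1 * t) *\<^sub>R v) ` \<Gamma> 0"
    using assms(3) unfolding acsf_translator_def by blast+
  then obtain M X where X: "acsf_solution g M UNIV X" and \<Gamma>: "\<And>t. \<Gamma> t = range (\<lambda>u. X u t)"
    unfolding acsf_flow_def by blast
  define \<gamma> where "\<gamma> = (\<lambda>u. X u 0)"
  have "embedded_curve M \<gamma>"
    using X by (simp add: acsf_solution_def \<gamma>_def)
  then have \<gamma>: "smooth_on UNIV \<gamma>" "\<And>u. vector_derivative \<gamma> (at u) \<noteq> 0"
    by (simp_all add: embedded_curve_def)
  obtain \<gamma>' where \<gamma>': "\<And>u. (\<gamma> has_vector_derivative \<gamma>' u) (at u)" "smooth_on UNIV \<gamma>'"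
    using \<gamma>(1) unfolding smooth_on_real_iff[of \<gamma>] by blast
  obtain \<gamma>'' where \<gamma>'': "\<And>u. (\<gamma>' has_vector_derivative \<gamma>'' u) (at u)"
    using \<gamma>'(2) unfolding smooth_on_real_iff[of \<gamma>'] by blast
  have vd: "vector_derivative \<gamma> (at u) = \<gamma>' u" for u
    by (rule vector_derivative_at[OF \<gamma>'(1)])
  have nz: "\<gamma>' u \<noteq> 0" for u
    using \<gamma>(2)[of u] by (simp add: vd)
  obtain K n where K: "bounds_convex_region \<gamma> K"
    and n: "\<And>u. is_outward_normal K \<gamma> u (n u)" "\<And>u. curvature \<gamma> u (n u) > 0"
    and velocity: "\<And>u. (X u has_vector_derivative
      (- (g (n u) * curvature \<gamma> u (n u))) *\<^sub>R n u) (at 0)"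
    using X unfolding acsf_solution_def \<gamma>_def by (simp, metis)
  have norm_n: "norm (n u) = 1" for u
    using n(1)[of u] by (simp add: is_outward_normal_def)
  have orth: "n u \<bullet> \<gamma>' u = 0" for u
    using n(1)[of u] nz[of u] by (simp add: is_outward_normal_def unit_tangent_def vd sgn_div_norm)
  have curvature: "curvature \<gamma> u (n u) = - (\<gamma>'' u \<bullet> n u) / (norm (\<gamma>' u))\<^sup>2" for u
    by (rule curvature_eq[OF \<gamma>'(1) \<gamma>'' nz orth])
  have concave: "\<gamma>'' u \<bullet> n u < 0" for u
    using n(2)[of u] nz[of u] unfolding curvature by (simp add: divide_less_0_iff)
  have speed: "g (n u) * curvature \<gamma> u (n u) = - (v \<bullet> n u)" for u
  proof -
    have "((\<lambda>t. X u t - t *\<^sub>R v) has_vector_derivative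
        (- (g (n u) * curvature \<gamma> u (n u))) *\<^sub>R n u - v) (at 0)"
      by (auto intro!: derivative_eq_intros velocity)
    note inner_const_deriv[OF this, of "n u"]
    moreover have "(X u t - t *\<^sub>R v) \<bullet> n u \<le> (X u 0 - 0 *\<^sub>R v) \<bullet> n u" for t
    proof -
      have "X u t \<in> (\<lambda>x. x + t *\<^sub>R v) ` range \<gamma>"
        using translates[of t] unfolding \<Gamma> \<gamma>_def mult_1 by blast
      then have "X u t - t *\<^sub>R v \<in> range \<gamma>"
        by force
      moreover have "range \<gamma> \<subseteq> K"
        using K unfolding bounds_convex_region_def by (metis frontier_subset_eq)
      ultimately have "X u t - t *\<^sub>R v \<in> K"
        by blast
      from convex_curve_support[OF K \<gamma>'(1) \<gamma>'' nz norm_n orth concave this]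
      show ?thesis
        by (simp add: \<gamma>_def)
    qed
    \<comment> \<open>Time 0 is interior to the time interval, so the derivative vanishes at the
      maximum.\<close>
    ultimately have "((- (g (n u) * curvature \<gamma> u (n u))) *\<^sub>R n u - v) \<bullet> n u = 0"
      by (intro DERIV_local_max[where d = 1]) auto
    then show ?thesis
      using norm_n[of u] by (simp add: inner_diff_left flip: power2_norm_eq_inner)
  qed
  have "\<exists>c. range \<gamma> = (\<lambda>x. x + c) ` range profile"
  proof (rule translating_curve_is_profile[OF \<gamma>'(1) \<gamma>'' nz _ g norm_n orth])
    show "closed (range \<gamma>)"
      using K unfolding bounds_convex_region_def by (metis frontier_closed)
    show "v \<bullet> n u < 0" for u
      using speed[of u] mult_pos_pos[OF g_pos[OF norm_n[of u]] n(2)[of u]] by simp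
    show "g (n u) * (\<gamma>'' u \<bullet> n u) / (norm (\<gamma>' u))\<^sup>2 = v \<bullet> n u" for u
      using speed[of u] by (simp add: curvature)
  qed
  then show ?thesis
    by (simp add: \<Gamma> \<gamma>_def)
qed

end

section \<open>Choice of the frame and conclusion\<close>

theorem proposition4p1:
  fixes g :: "plane \<Rightarrow> real" and v :: plane
  assumes "smooth_on_circle g"
    and "\<And>n. n \<in> sphere 0 1 \<Longrightarrow> g n > 0"
    and "v \<in> sphere 0 1"
  shows "(\<exists>\<Gamma>. acsf_translator g v 1 \<Gamma>) \<and>
    (\<forall>\<Gamma> \<Gamma>'. acsf_translator g v 1 \<Gamma> \<longrightarrow> acsf_translator g v 1 \<Gamma>' \<longrightarrow>
       (\<exists>p t\<^sub>0. \<forall>t. \<Gamma>' t = (\<lambda>x. x + p) ` \<Gamma> (t + t\<^sub>0)))"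
proof -
  have "(v $ 1)\<^sup>2 + (v $ 2)\<^sup>2 = 1"
    using assms(3) by (simp add: norm_eq_sqrt_inner inner_vec_def sum_2 power2_eq_square)
  then obtain \<beta> where \<beta>: "v $ 1 = cos \<beta>" "v $ 2 = sin \<beta>"
    using sincos_total_2pi by metis
  have v: "v = vector [cos \<beta>, sin \<beta>]"
    using \<beta> by (simp add: vec_eq_iff forall_2)
  \<comment> \<open>The vector \<open>v\<close> turned clockwise by a right angle, so that the frame
    \<open>(e, v)\<close> is positively oriented.\<close>
  define e :: plane where "e = vector [sin \<beta>, - cos \<beta>]"
  define circ :: "real \<Rightarrow> plane" where "circ \<theta> = vector [cos \<theta>, sin \<theta>]" for \<theta>
  have g_circ: "smooth_on UNIV (\<lambda>\<theta>. g (circ \<theta>))"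
    using assms(1) by (simp add: smooth_on_circle_def circ_def)
  have norm_circ: "norm (circ \<theta>) = 1" for \<theta>
    by (simp add: circ_def norm_eq_sqrt_inner vector_plane_inner flip: power2_eq_square)
  \<comment> \<open>The angle \<open>\<beta> + pi\<close> belongs to \<open>- v\<close>, and turning
    by \<open>arctan p\<close> from there gives \<open>normal p\<close>. As \<open>p\<close> varies,
    the open half circle around \<open>- v\<close> is swept out.\<close>
  define G where "G p = g (circ (\<beta> + pi + arctan p))" for p
  have "smooth_on UNIV (\<lambda>p. \<beta> + pi + arctan p)"
    by (intro smooth_on_add smooth_on_const smooth_on_arctan)
  from smooth_on_compose[OF g_circ this] have smooth_G: "smooth_on UNIV G"
    by (simp add: G_def[abs_def])
  \<comment> \<open>Slopes reach only the open half circle; on the compact closed one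
    \<open>g\<close> attains a minimum, which is positive and bounds \<open>G\<close> uniformly from
    below.\<close>
  let ?I = "{\<beta> + pi - pi / 2..\<beta> + pi + pi / 2}"
  have "continuous_on ?I (\<lambda>\<theta>. g (circ \<theta>))"
    using smooth_on_imp_continuous_on[OF g_circ] continuous_on_subset by blast
  then have "\<exists>\<theta>\<^sub>0\<in>?I. \<forall>\<theta>\<in>?I. g (circ \<theta>\<^sub>0) \<le> g (circ \<theta>)"
    by (intro continuous_attains_inf) auto
  then obtain \<theta>\<^sub>0 where \<theta>\<^sub>0: "\<And>\<theta>. \<theta> \<in> ?I \<Longrightarrow> g (circ \<theta>\<^sub>0) \<le> g (circ \<theta>)"
    by blast
  define m where "m = g (circ \<theta>\<^sub>0)"
  have "m > 0"
    using assms(2)[of "circ \<theta>\<^sub>0"] by (simp add: m_def norm_circ)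
  have m_le: "m \<le> G p" for p
    unfolding m_def G_def
    by (rule \<theta>\<^sub>0) (use arctan_bounded[of p] in auto)
  have continuous_G: "continuous_on UNIV G"
    by (rule smooth_on_imp_continuous_on[OF smooth_G])
  have nz: "1 + p\<^sup>2 \<noteq> (0::real)" for p
    by (metis add_pos_nonneg less_irrefl zero_le_power2 zero_less_one)
  have "continuous_on UNIV (\<lambda>p. G p / (1 + p\<^sup>2))"
    by (intro continuous_intros continuous_G ballI nz)
  then obtain a where a: "\<And>p. (a has_real_derivative G p / (1 + p\<^sup>2)) (at p)"
    using continuous_real_antiderivative by blast
  have "continuous_on UNIV (\<lambda>p. p * G p / (1 + p\<^sup>2))"
    by (intro continuous_intros continuous_G ballI nz)
  then obtain b where b: "\<And>p. (b has_real_derivative p * G p / (1 + p\<^sup>2)) (at p)"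
    using continuous_real_antiderivative by blast
  interpret translator_profile e v G m a b
  proof
    show "e \<bullet> e = 1" "v \<bullet> v = 1" "e \<bullet> v = 0"
      by (simp_all add: e_def v vector_plane_inner flip: power2_eq_square)
  qed (fact smooth_G \<open>m > 0\<close> m_le a b)+
  have circ_normal: "circ (\<beta> + pi + arctan p) = normal p" for p
  proof -
    have "circ (\<beta> + pi + arctan p) = cos (arctan p) *\<^sub>R (p *\<^sub>R e - v)"
    proof -
      have "sin (arctan p) = p * cos (arctan p)"
        by (simp add: sin_arctan cos_arctan)
      then show ?thesis
        unfolding circ_def e_def v
        by (simp add: vec_eq_iff forall_2 cos_add sin_add algebra_simps)
    qed
    then show ?thesis
      by (simp add: normal_def cos_arctan)
  qed
  then have G: "G p = g (normal p)" for p
    by (simp add: G_def)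
  have g_pos: "g n > 0" if "norm n = 1" for n
    using assms(2) that by simp
  have "\<exists>p t\<^sub>0. \<forall>t. \<Gamma>' t = (\<lambda>x. x + p) ` \<Gamma> (t + t\<^sub>0)"
    if \<Gamma>: "acsf_translator g v 1 \<Gamma>" and \<Gamma>': "acsf_translator g v 1 \<Gamma>'" for \<Gamma> \<Gamma>'
  proof -
    obtain c c' where c: "\<Gamma> 0 = (\<lambda>x. x + c) ` range profile" "\<Gamma>' 0 = (\<lambda>x. x + c') ` range profile"
      using translator_slice[OF G g_pos \<Gamma>] translator_slice[OF G g_pos \<Gamma>'] by blast
    have "\<Gamma> t = (\<lambda>x. x + t *\<^sub>R v) ` \<Gamma> 0" "\<Gamma>' t = (\<lambda>x. x + t *\<^sub>R v) ` \<Gamma>' 0" for t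
      using \<Gamma> \<Gamma>' unfolding acsf_translator_def by (metis mult_1)+
    \<comment> \<open>Both initial slices are translates of the same profile and both move with
      velocity \<open>v\<close>, so a spatial translation alone matches them at all times and the
      time shift can be 0.\<close>
    then have "\<Gamma>' t = (\<lambda>x. x + (c' - c)) ` \<Gamma> (t + 0)" for t
      by (simp add: c image_image algebra_simps)
    then show ?thesis
      by blast
  qed
  with exists_translator[OF G] show ?thesis
    by blast
qed

end
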